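(* Let $0<p<2$. There exists a positive constant $C_p$ (depending only on $p$) such that for every $n\in\mathbb N$ and every real $n$-dimensional Banach space $E=(\mathbb R^n,\|\cdot\|_E)$, $$C_p\,\pi_2\left(i_{E,2}:E\to\ell_2^n\right)^p\le M_p(B_E,d_2),$$ where $i_{E,2}:E\to\ell_2^n$, $i_{E,2}(x)=x$, is the formal identity.
   Context: $B_E$ is the closed unit ball of $E$; $d_2(x,y)=\|x-y\|_2$ is the Euclidean distance; $\ell_2^n$ is $\mathbb R^n$ with the Euclidean norm. For a compact set $K\subset\mathbb R^n$, $\mathfrak M^1(K)$ is the set of finite signed Borel measures $\mu$ on $K$ with $\mu(K)=1$, and $M_p(K,d_2)=\sup\{\int_K\int_K\|x-y\|_2^p\,d\mu(x)d\mu(y):\mu\in\mathfrak M^1(K)\}$. For a linear operator $T:E\to F$ between finite-dimensional normed spaces, the absolutely $2$-summing norm $\pi_2(T)$ is the least $C\ge0$ such that for all finite families $x_1,\dots,x_m\in E$, $\left(\sum_i\|Tx_i\|_F^2\right)^{1/2}\le C\sup_{x'\in B_{E'}}\left(\sum_i|x'(x_i)|^2\right)^{1/2}$, where $B_{E'}$ is the closed unit ball of the dual of $E$. *)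

theory Defs
  imports "HOL-Analysis.Analysis"
begin

section \<open>Finite signed measures\<close>

text \<open>
  A finite signed measure on the measurable space \<open>M\<close> is a real-valued countably additive set
  function on \<^term>\<open>sets M\<close>; only the measurable structure of \<open>M\<close> is used, and the values of
  \<open>\<nu>\<close> on non-measurable sets are irrelevant.
\<close>

definition signed_measure :: "'a measure \<Rightarrow> ('a set \<Rightarrow> real) \<Rightarrow> bool" where
  "signed_measure M \<nu> \<longleftrightarrow>
     \<nu> {} = 0 \<and>
     (\<forall>A :: nat \<Rightarrow> 'a set. range A \<subseteq> sets M \<longrightarrow> disjoint_family A \<longrightarrow>
        (\<lambda>i. \<nu> (A i)) sums \<nu> (\<Union>i. A i))"

text \<open>
  The positive part \<open>\<nu>\<^sup>+ A = sup {\<nu> B | B \<subseteq> A measurable}\<close> of the Jordan decomposition. The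
  truncation of negative values by \<^const>\<open>ennreal\<close> does not matter, as \<open>B = {}\<close> contributes
  \<open>0\<close>. The negative part is the positive part of \<open>-\<nu>\<close>.
\<close>

definition jordan_pos :: "'a measure \<Rightarrow> ('a set \<Rightarrow> real) \<Rightarrow> 'a measure" where
  "jordan_pos M \<nu> =
     measure_of (space M) (sets M) (\<lambda>A. SUP B \<in> {B \<in> sets M. B \<subseteq> A}. ennreal (\<nu> B))"

definition jordan_neg :: "'a measure \<Rightarrow> ('a set \<Rightarrow> real) \<Rightarrow> 'a measure" where
  "jordan_neg M \<nu> = jordan_pos M (\<lambda>A. - \<nu> A)"

definition signed_integral :: "'a measure \<Rightarrow> ('a set \<Rightarrow> real) \<Rightarrow> ('a \<Rightarrow> real) \<Rightarrow> real" where
  "signed_integral M \<nu> f =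
     integral\<^sup>L (jordan_pos M \<nu>) f - integral\<^sup>L (jordan_neg M \<nu>) f"

definition signed_prob :: "'a::topological_space set \<Rightarrow> ('a set \<Rightarrow> real) set" where
  "signed_prob K = {\<mu>. signed_measure (restrict_space borel K) \<mu> \<and> \<mu> K = 1}"

definition max_energy ::
    "real \<Rightarrow> 'a::topological_space set \<Rightarrow> ('a \<Rightarrow> 'a \<Rightarrow> real) \<Rightarrow> ereal" where
  "max_energy p K d =
     (SUP \<mu> \<in> signed_prob K.
        ereal (signed_integral (restrict_space borel K) \<mu>
          (\<lambda>y. signed_integral (restrict_space borel K) \<mu> (\<lambda>x. d x y powr p))))"

section \<open>Normed spaces on $\mathbb{R}^n$\<close>

text \<open>
  Since the constant in the theorem has to be uniform in the dimension, \<open>\<real>\<^sup>n\<close> is a subset of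
  a single type: the sequences vanishing from index \<open>n\<close> on. The product topology of
  \<^typ>\<open>nat \<Rightarrow> real\<close> induces the Euclidean topology on it, so that \<^const>\<open>borel\<close> restricted
  to a subset \<open>K\<close> is the Borel \<open>\<sigma>\<close>-algebra of \<open>K\<close>. Norms, functionals and operators are
  functions on the whole type of which only the values on \<open>\<real>\<^sup>n\<close> matter.
\<close>

definition Rn :: "nat \<Rightarrow> (nat \<Rightarrow> real) set" where
  "Rn n = {x. \<forall>i\<ge>n. x i = 0}"

definition is_norm :: "nat \<Rightarrow> ((nat \<Rightarrow> real) \<Rightarrow> real) \<Rightarrow> bool" where
  "is_norm n N \<longleftrightarrow>
     (\<forall>x\<in>Rn n. 0 \<le> N x \<and> (N x = 0 \<longleftrightarrow> x = (\<lambda>_. 0))) \<and>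
     (\<forall>x\<in>Rn n. \<forall>c. N (\<lambda>i. c * x i) = \<bar>c\<bar> * N x) \<and>
     (\<forall>x\<in>Rn n. \<forall>y\<in>Rn n. N (\<lambda>i. x i + y i) \<le> N x + N y)"

definition unit_ball :: "nat \<Rightarrow> ((nat \<Rightarrow> real) \<Rightarrow> real) \<Rightarrow> (nat \<Rightarrow> real) set" where
  "unit_ball n N = {x \<in> Rn n. N x \<le> 1}"

definition norm2 :: "nat \<Rightarrow> (nat \<Rightarrow> real) \<Rightarrow> real" where
  "norm2 n x = L2_set x {..<n}"

definition dist2 :: "nat \<Rightarrow> (nat \<Rightarrow> real) \<Rightarrow> (nat \<Rightarrow> real) \<Rightarrow> real" where
  "dist2 n x y = norm2 n (\<lambda>i. x i - y i)"

definition linear_functional :: "nat \<Rightarrow> ((nat \<Rightarrow> real) \<Rightarrow> real) \<Rightarrow> bool" where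
  "linear_functional n \<phi> \<longleftrightarrow>
     (\<forall>x\<in>Rn n. \<forall>y\<in>Rn n. \<phi> (\<lambda>i. x i + y i) = \<phi> x + \<phi> y) \<and>
     (\<forall>x\<in>Rn n. \<forall>c. \<phi> (\<lambda>i. c * x i) = c * \<phi> x)"

definition dual_ball :: "nat \<Rightarrow> ((nat \<Rightarrow> real) \<Rightarrow> real) \<Rightarrow> ((nat \<Rightarrow> real) \<Rightarrow> real) set" where
  "dual_ball n N = {\<phi>. linear_functional n \<phi> \<and> (\<forall>x\<in>unit_ball n N. \<bar>\<phi> x\<bar> \<le> 1)}"

text \<open>
  The absolutely 2-summing norm of \<open>T : (\<real>\<^sup>n, N) \<rightarrow> (F, N')\<close>. The set of admissible constants is
  closed and, in finite dimensions, nonempty, so its infimum is its least element.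
\<close>

definition pi2 ::
    "nat \<Rightarrow> ((nat \<Rightarrow> real) \<Rightarrow> real) \<Rightarrow> ('b \<Rightarrow> real) \<Rightarrow> ((nat \<Rightarrow> real) \<Rightarrow> 'b) \<Rightarrow> real" where
  "pi2 n N N' T =
     Inf {C. 0 \<le> C \<and>
       (\<forall>m. \<forall>x :: nat \<Rightarrow> nat \<Rightarrow> real. (\<forall>i<m. x i \<in> Rn n) \<longrightarrow>
          sqrt (\<Sum>i<m. (N' (T (x i)))\<^sup>2)
            \<le> C * (SUP \<phi>\<in>dual_ball n N. sqrt (\<Sum>i<m. \<bar>\<phi> (x i)\<bar>\<^sup>2)))}"

end

(*
  A bound on the 2-summing norm is tested on a family x_1, ..., x_m whose weak norm is at most 1.
  By Hahn-Banach, v(y) = sum y_i x_i then maps the Euclidean unit ball of R^m into the unit ball of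
  E, and s^2 = sum |x_i|^2 is the square of the Hilbert-Schmidt norm of v. Let S_K be the sum of K
  independent random sign vectors in R^m. If E |v(S_K)|^p were exactly proportional to K^(p/2), a
  signed combination sum_k c_k law(v(S_k)) would have energy proportional to
  sum_{k,l} c_k c_l (k+l)^(p/2). Writing u^(p/2) as a multiple of the integral of
  (1 - exp(-t u)) t^(-1-p/2), this is the integral of (1 - P(exp(-t))^2) t^(-1-p/2) for the
  polynomial P with coefficients c_k. For the Chebyshev polynomial of degree m it is at least a
  multiple of m^p, since P^2 <= 1/2 on an interval of t of length and distance
  to 0 of order 1/m^2. This gain makes up for the scaling by
  1/m that moves S_K, K <= m, into the unit ball of R^m.

  By moment bounds E |v(S_K)|^p / (s^2 K)^(p/2) only lies between positive constants. Replacing S_k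
  by S_(kL) and averaging over the multiplicative semigroup of all L shows that some L does as well
  as exact proportionality. The S_(kL) leave the unit ball with probability exp(-D m), where D can
  be chosen as large as necessary, and this beats the total variation 3^m of the combination.
*)
theory Submission
  imports Defs "HOL-Probability.Probability" "HOL-Library.Function_Algebras"
    "HOL-Computational_Algebra.Polynomial"
begin

section \<open>Finitely supported signed measures\<close>

definition point_charge :: "'a set \<Rightarrow> ('a \<Rightarrow> real) \<Rightarrow> 'a set \<Rightarrow> real" where
  "point_charge F w A = (\<Sum>x\<in>F \<inter> A. w x)"

lemma point_charge_eq_sum_indicator:
  assumes "finite F"
  shows "point_charge F w A = (\<Sum>x\<in>F. w x * indicator A x)"
  unfolding point_charge_def using assms
  by (auto simp: indicator_def sum.inter_restrict intro!: sum.cong)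

lemma signed_measure_point_charge:
  assumes "finite F"
  shows "signed_measure M (point_charge F w)"
  unfolding signed_measure_def
proof (intro conjI allI impI)
  show "point_charge F w {} = 0" by (simp add: point_charge_def)
  fix A :: "nat \<Rightarrow> 'a set"
  assume "disjoint_family A"
  have "(\<lambda>i. indicator (A i) x) sums (indicator (\<Union>i. A i) x :: real)" for x
  proof (cases "\<exists>i. x \<in> A i")
    case True
    then obtain i where i: "x \<in> A i" by auto
    then have "indicator (A j) x = (if j = i then 1 else 0 :: real)" for j
      using \<open>disjoint_family A\<close> by (auto simp: indicator_def disjoint_family_on_def)
    then show ?thesis using True sums_single[of i "\<lambda>_. 1 :: real"] by simp
  qed simp
  then show "(\<lambda>i. point_charge F w (A i)) sums point_charge F w (\<Union>i. A i)"
    unfolding point_charge_eq_sum_indicator[OF assms]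
    by (intro sums_sum sums_mult)
qed

text \<open>The supremum is attained at the set of points of \<open>F \<inter> A\<close> with
  positive weight. \<open>ennreal\<close> truncates negative weights, so the point measure is
  already the positive part; \<open>distr\<close> along \<open>id\<close> only carries it to the
  \<sigma>-algebra of \<open>M\<close>.\<close>

lemma jordan_pos_point_charge:
  assumes F: "finite F" "F \<subseteq> space M" and sing: "\<And>x. x \<in> F \<Longrightarrow> {x} \<in> sets M"
  shows "jordan_pos M (point_charge F w) = distr (point_measure F (\<lambda>x. ennreal (w x))) M id"
proof -
  let ?D = "distr (point_measure F (\<lambda>x. ennreal (w x))) M id"
  have meas: "id \<in> measurable (point_measure F (\<lambda>x. ennreal (w x))) M"
    using F by (auto simp: measurable_def sets_point_measure space_point_measure)
  have em: "emeasure ?D A = (\<Sum>x\<in>F \<inter> A. ennreal (w x))" if "A \<in> sets M" for A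
  proof -
    have "emeasure ?D A = emeasure (point_measure F (\<lambda>x. ennreal (w x))) (A \<inter> F)"
      using that by (subst emeasure_distr[OF meas]) (auto simp: space_point_measure)
    also have "\<dots> = (\<Sum>x\<in>A \<inter> F. ennreal (w x))"
      using F by (subst emeasure_point_measure_finite) auto
    finally show ?thesis by (simp add: Int_commute)
  qed
  have "(SUP B \<in> {B \<in> sets M. B \<subseteq> A}. ennreal (point_charge F w B)) = emeasure ?D A"
    if A: "A \<in> sets M" for A
  proof (rule antisym)
    show "(SUP B \<in> {B \<in> sets M. B \<subseteq> A}. ennreal (point_charge F w B)) \<le> emeasure ?D A"
    proof (rule SUP_least)
      fix B assume B: "B \<in> {B \<in> sets M. B \<subseteq> A}"
      have "point_charge F w B \<le> (\<Sum>x\<in>F \<inter> B. max 0 (w x))"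
        unfolding point_charge_def by (rule sum_mono) auto
      then have "ennreal (point_charge F w B) \<le> (\<Sum>x\<in>F \<inter> B. ennreal (max 0 (w x)))"
        by (subst sum_ennreal) (auto intro: ennreal_leI)
      also have "\<dots> = (\<Sum>x\<in>F \<inter> B. ennreal (w x))"
        by (intro sum.cong refl) (auto simp: max_def ennreal_neg)
      also have "\<dots> \<le> (\<Sum>x\<in>F \<inter> A. ennreal (w x))"
        using B F by (intro sum_mono2) auto
      finally show "ennreal (point_charge F w B) \<le> emeasure ?D A" using em[OF A] by simp
    qed
    let ?B = "F \<inter> A \<inter> {x. 0 < w x}"
    have "?B \<in> sets M"
      by (rule sets.countable) (use F sing in \<open>auto simp: countable_finite\<close>)
    then have "ennreal (point_charge F w ?B) \<le> (SUP B \<in> {B \<in> sets M. B \<subseteq> A}. ennreal (point_charge F w B))"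
      by (intro SUP_upper) auto
    moreover have "emeasure ?D A = ennreal (point_charge F w ?B)"
    proof -
      have "(\<Sum>x\<in>F \<inter> A. ennreal (w x)) = (\<Sum>x\<in>?B. ennreal (w x))"
        using F by (intro sum.mono_neutral_right) (auto simp: ennreal_neg not_less)
      also have "\<dots> = ennreal (\<Sum>x\<in>?B. w x)" by (rule sum_ennreal) auto
      also have "\<dots> = ennreal (point_charge F w ?B)"
        unfolding point_charge_def by (intro arg_cong[where f=ennreal] sum.cong) auto
      finally show ?thesis using em[OF A] by simp
    qed
    ultimately show "emeasure ?D A \<le> (SUP B \<in> {B \<in> sets M. B \<subseteq> A}. ennreal (point_charge F w B))"
      by simp
  qed
  then have "jordan_pos M (point_charge F w) = measure_of (space M) (sets M) (emeasure ?D)"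
    unfolding jordan_pos_def by (intro measure_of_eq) (auto simp: sets.space_closed sets.sigma_sets_eq)
  also have "\<dots> = ?D" using measure_of_of_measure[of ?D] by simp
  finally show ?thesis .
qed

text \<open>The negative part is the positive part for the weights \<open>- w\<close>, and
  \<open>max 0 w - max 0 (- w) = w\<close>.\<close>

lemma signed_integral_point_charge:
  fixes f :: "'a \<Rightarrow> real"
  assumes F: "finite F" "F \<subseteq> space M" and sing: "\<And>x. x \<in> F \<Longrightarrow> {x} \<in> sets M"
    and f: "f \<in> borel_measurable M"
  shows "signed_integral M (point_charge F w) f = (\<Sum>x\<in>F. w x * f x)"
proof -
  have meas: "id \<in> measurable (point_measure F (\<lambda>x. ennreal (v x))) M" for v
    using F by (auto simp: measurable_def sets_point_measure space_point_measure)
  have int: "integral\<^sup>L (jordan_pos M (point_charge F v)) f = (\<Sum>x\<in>F. max 0 (v x) * f x)" for v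
  proof -
    have "point_measure F (\<lambda>x. ennreal (v x)) = point_measure F (\<lambda>x. ennreal (max 0 (v x)))"
      by (rule arg_cong[where f="point_measure F"]) (auto simp: max_def ennreal_neg)
    then have "integral\<^sup>L (point_measure F (\<lambda>x. ennreal (v x))) f = (\<Sum>x\<in>F. max 0 (v x) * f x)"
      using lebesgue_integral_point_measure_finite[OF F(1), of "\<lambda>x. max 0 (v x)" f] by simp
    then show ?thesis
      using integral_distr[OF meas f, of v] by (simp add: jordan_pos_point_charge[OF F sing])
  qed
  have neg: "(\<lambda>A. - point_charge F w A) = point_charge F (\<lambda>x. - w x)"
    by (auto simp: point_charge_def sum_negf)
  have "signed_integral M (point_charge F w) f = (\<Sum>x\<in>F. max 0 (w x) * f x - max 0 (- w x) * f x)"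
    unfolding signed_integral_def jordan_neg_def neg int sum_subtractf ..
  also have "\<dots> = (\<Sum>x\<in>F. w x * f x)"
    by (intro sum.cong refl) (auto simp: max_def)
  finally show ?thesis .
qed

text \<open>A list may repeat a point; its weights there are added. This spares computing the point
  masses of the law of a random vector.\<close>

lemma sum_list_group_points:
  fixes f :: "'a \<Rightarrow> real"
  assumes "finite F" "snd ` set l \<subseteq> F"
  shows "(\<Sum>(c, z)\<leftarrow>l. c * f z) = (\<Sum>x\<in>F. (\<Sum>(c, z)\<leftarrow>l. if z = x then c else 0) * f x)"
  using assms(2)
proof (induction l)
  case (Cons a l)
  obtain c z where a: "a = (c, z)" by force
  have "c * f z = (\<Sum>x\<in>F. (if z = x then c else 0) * f x)"
    using Cons.prems assms(1) sum.delta'[of F z "\<lambda>x. c * f x"]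
    by (simp add: a if_distrib[of "\<lambda>t. t * _"] cong: if_cong)
  then show ?case using Cons by (simp add: a sum.distrib distrib_right)
qed simp

text \<open>All lower bounds on the energy come from here: a weighted list of points in
  \<open>K\<close> with total weight 1 is a competitor in the supremum.\<close>

lemma energy_list_le_max_energy:
  fixes K :: "'a::{t2_space} set" and l :: "(real \<times> 'a) list"
  assumes l: "snd ` set l \<subseteq> K" "(\<Sum>(c, z)\<leftarrow>l. c) = 1"
    and d: "\<And>y. (\<lambda>x. d x y) \<in> borel_measurable borel" "\<And>x. (\<lambda>y. d x y) \<in> borel_measurable borel"
  shows "ereal (\<Sum>(c, y)\<leftarrow>l. c * (\<Sum>(c', x)\<leftarrow>l. c' * d x y powr p)) \<le> max_energy p K d"
proof -
  define F where "F = snd ` set l"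
  define w where "w x = (\<Sum>(c, z)\<leftarrow>l. if z = x then c else 0)" for x
  let ?M = "restrict_space borel K"
  have fin: "finite F" and FK: "F \<subseteq> space ?M" using l by (auto simp: F_def space_restrict_space)
  have sing: "{x} \<in> sets ?M" if "x \<in> F" for x
    using that l by (auto simp: sets_restrict_space F_def intro!: image_eqI[of _ _ "{x}"])
  have l_eq: "(\<Sum>(c, z)\<leftarrow>l. c * f z) = (\<Sum>x\<in>F. w x * f x)" for f
    unfolding w_def by (rule sum_list_group_points[OF fin]) (simp add: F_def)
  have "point_charge F w \<in> signed_prob K"
  proof -
    have "F \<inter> K = F" using l by (auto simp: F_def)
    then have "point_charge F w K = 1"
      using l(2) l_eq[of "\<lambda>_. 1"] by (simp add: point_charge_def)
    then show ?thesis
      using signed_measure_point_charge[OF fin] by (simp add: signed_prob_def)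
  qed
  moreover have inner: "signed_integral ?M (point_charge F w) (\<lambda>x. d x y powr p) = (\<Sum>x\<in>F. w x * d x y powr p)" for y
    using d by (intro signed_integral_point_charge fin FK sing measurable_restrict_space1) measurable
  moreover have "signed_integral ?M (point_charge F w) (\<lambda>y. \<Sum>x\<in>F. w x * d x y powr p) =
      (\<Sum>y\<in>F. w y * (\<Sum>x\<in>F. w x * d x y powr p))"
    using d by (intro signed_integral_point_charge fin FK sing measurable_restrict_space1) measurable
  moreover have "(\<Sum>(c, y)\<leftarrow>l. c * (\<Sum>(c', x)\<leftarrow>l. c' * d x y powr p)) =
      (\<Sum>y\<in>F. w y * (\<Sum>x\<in>F. w x * d x y powr p))"
    unfolding l_eq ..
  ultimately show ?thesis
    unfolding max_energy_def by (intro SUP_upper2[of "point_charge F w"]) auto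
qed

section \<open>Norming functionals and the 2-summing norm\<close>

definition sublinear :: "nat \<Rightarrow> ((nat \<Rightarrow> real) \<Rightarrow> real) \<Rightarrow> bool" where
  "sublinear n f \<longleftrightarrow>
     (\<forall>x\<in>Rn n. \<forall>y\<in>Rn n. f (\<lambda>i. x i + y i) \<le> f x + f y) \<and>
     (\<forall>x\<in>Rn n. \<forall>c\<ge>0. f (\<lambda>i. c * x i) = c * f x)"

lemma Rn_closed [simp, intro]:
  "x \<in> Rn n \<Longrightarrow> y \<in> Rn n \<Longrightarrow> (\<lambda>i. x i + y i) \<in> Rn n"
  "x \<in> Rn n \<Longrightarrow> (\<lambda>i. c * x i) \<in> Rn n"
  "x \<in> Rn n \<Longrightarrow> (\<lambda>i. - x i) \<in> Rn n"
  "(\<lambda>_. 0) \<in> Rn n"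
  by (auto simp: Rn_def)

context
  fixes n f
  assumes f: "sublinear n f"
begin

lemma sublinear_add: "x \<in> Rn n \<Longrightarrow> y \<in> Rn n \<Longrightarrow> f (\<lambda>i. x i + y i) \<le> f x + f y"
  and sublinear_scale: "x \<in> Rn n \<Longrightarrow> 0 \<le> c \<Longrightarrow> f (\<lambda>i. c * x i) = c * f x"
  using f by (auto simp: sublinear_def)

lemma sublinear_zero: "f (\<lambda>_. 0) = 0"
  using sublinear_scale[of "\<lambda>_. 0" 0] by simp

lemma sublinear_neg: "x \<in> Rn n \<Longrightarrow> 0 \<le> f x + f (\<lambda>i. - x i)"
  using sublinear_add[of x "\<lambda>i. - x i"] sublinear_zero by simp

lemma sublinear_scale_ge: "x \<in> Rn n \<Longrightarrow> c * f x \<le> f (\<lambda>i. c * x i)"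
proof (cases "0 \<le> c")
  case False
  assume x: "x \<in> Rn n"
  then have "f (\<lambda>i. (- c) * x i) = (- c) * f x" using False by (intro sublinear_scale) auto
  then show ?thesis using sublinear_neg[of "\<lambda>i. c * x i"] x by simp
qed (simp add: sublinear_scale)

text \<open>The vectors along which \<open>f\<close> is odd form a linear subspace. It contains the
  basis, so \<open>f\<close> is odd everywhere, and an odd sublinear function is linear.\<close>

lemma linear_functional_if_odd_on_basis:
  assumes "\<And>i. i < n \<Longrightarrow> f (\<lambda>j. if j = i then 1 else 0) + f (\<lambda>j. if j = i then - 1 else 0) \<le> 0"
  shows "linear_functional n f"
proof -
  define L where "L = {x \<in> Rn n. f x + f (\<lambda>i. - x i) \<le> 0}"
  have L_add: "(\<lambda>i. x i + y i) \<in> L" if "x \<in> L" "y \<in> L" for x y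
  proof -
    have "f (\<lambda>i. x i + y i) \<le> f x + f y" "f (\<lambda>i. - x i + - y i) \<le> f (\<lambda>i. - x i) + f (\<lambda>i. - y i)"
      using that sublinear_add[of x y] sublinear_add[of "\<lambda>i. - x i" "\<lambda>i. - y i"] by (auto simp: L_def)
    then show ?thesis using that by (auto simp: L_def)
  qed
  have L_pos: "(\<lambda>i. c * x i) \<in> L" if "x \<in> L" "0 \<le> c" for x c
  proof -
    have "f (\<lambda>i. c * x i) = c * f x" "f (\<lambda>i. c * - x i) = c * f (\<lambda>i. - x i)"
      using that sublinear_scale[of x c] sublinear_scale[of "\<lambda>i. - x i" c] by (auto simp: L_def)
    moreover have "c * (f x + f (\<lambda>i. - x i)) \<le> 0"
      using that by (auto simp: L_def mult_le_0_iff)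
    ultimately show ?thesis using that by (auto simp: L_def distrib_left)
  qed
  have L_neg: "(\<lambda>i. - x i) \<in> L" if "x \<in> L" for x
    using that by (auto simp: L_def add.commute)
  have L_scale: "(\<lambda>i. c * x i) \<in> L" if "x \<in> L" for x c
    using L_pos[OF that, of c] L_neg[OF L_pos[OF that, of "- c"]] by (cases "0 \<le> c") auto
  have "(\<lambda>i. if i < k then x i else 0) \<in> L" if "k \<le> n" for x k
    using that
  proof (induction k)
    case 0
    then show ?case using sublinear_zero by (auto simp: L_def)
  next
    case (Suc k)
    have "(\<lambda>j. if j = k then 1 else 0) \<in> L"
      using assms[of k] Suc.prems by (auto simp: L_def Rn_def if_distrib cong: if_cong)
    then have "(\<lambda>j. x k * (if j = k then 1 else 0)) \<in> L" by (rule L_scale)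
    then have "(\<lambda>i. (if i < k then x i else 0) + x k * (if i = k then 1 else 0)) \<in> L"
      using Suc by (intro L_add) auto
    also have "(\<lambda>i. (if i < k then x i else 0) + x k * (if i = k then 1 else 0)) = (\<lambda>i. if i < Suc k then x i else 0)"
      by (auto simp: fun_eq_iff less_Suc_eq)
    finally show ?case .
  qed
  moreover have "(\<lambda>i. if i < n then x i else 0) = x" if "x \<in> Rn n" for x
    using that by (auto simp: Rn_def fun_eq_iff)
  ultimately have L: "x \<in> L" if "x \<in> Rn n" for x using that by (metis order_refl)
  have odd: "f (\<lambda>i. - x i) = - f x" if "x \<in> Rn n" for x
    using L[OF that] sublinear_neg[OF that] by (auto simp: L_def)
  have "f (\<lambda>i. x i + y i) = f x + f y" if x: "x \<in> Rn n" and y: "y \<in> Rn n" for x y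
  proof (rule antisym[OF sublinear_add[OF x y]])
    have "f (\<lambda>i. - x i + - y i) \<le> f (\<lambda>i. - x i) + f (\<lambda>i. - y i)"
      using x y by (intro sublinear_add) auto
    then show "f x + f y \<le> f (\<lambda>i. x i + y i)"
      using odd[OF x] odd[OF y] odd[of "\<lambda>i. x i + y i"] x y by simp
  qed
  moreover have "f (\<lambda>i. c * x i) = c * f x" if x: "x \<in> Rn n" for x c
  proof (cases "0 \<le> c")
    case False
    then show ?thesis
      using sublinear_scale[OF x, of "- c"] odd[of "\<lambda>i. c * x i"] x by simp
  qed (use x in \<open>simp add: sublinear_scale\<close>)
  ultimately show ?thesis by (simp add: linear_functional_def)
qed

text \<open>The largest sublinear minorant of \<open>f\<close> that is linear along \<open>e\<close> and equals \<open>f e\<close> there.\<close>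

lemma ex_sublinear_minorant:
  assumes e: "e \<in> Rn n"
  obtains g where "sublinear n g" "\<And>x. x \<in> Rn n \<Longrightarrow> g x \<le> f x" "g (\<lambda>i. - e i) \<le> - f e"
proof -
  define h where "h x t = f (\<lambda>i. x i + t * e i) - t * f e" for x t
  define g where "g x = Inf (range (h x))" for x
  \<comment> \<open>This bound does not depend on \<open>t\<close>, so the infimum defining
    \<open>g\<close> is over a set bounded below.\<close>
  have lower: "- f (\<lambda>i. - x i) \<le> h x t" if x: "x \<in> Rn n" for x t
  proof -
    have "t * f e \<le> f (\<lambda>i. t * e i)" using e by (rule sublinear_scale_ge)
    also have "\<dots> \<le> f (\<lambda>i. x i + t * e i) + f (\<lambda>i. - x i)"
      using sublinear_add[of "\<lambda>i. x i + t * e i" "\<lambda>i. - x i"] x e by simp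
    finally show ?thesis by (simp add: h_def)
  qed
  have le: "g x \<le> h x t" if "x \<in> Rn n" for x t
    unfolding g_def using lower[OF that] by (intro cInf_lower bdd_belowI[of _ "- f (\<lambda>i. - x i)"]) auto
  have ge: "a \<le> g x" if "\<And>t. a \<le> h x t" for a x
    unfolding g_def using that by (intro cInf_greatest) auto
  have "g (\<lambda>i. x i + y i) \<le> g x + g y" if x: "x \<in> Rn n" and y: "y \<in> Rn n" for x y
  proof -
    have "g (\<lambda>i. x i + y i) \<le> h x t + h y s" for t s
    proof -
      have "f (\<lambda>i. (x i + t * e i) + (y i + s * e i)) \<le> f (\<lambda>i. x i + t * e i) + f (\<lambda>i. y i + s * e i)"
        using x y e by (intro sublinear_add) auto
      moreover have "(\<lambda>i. (x i + t * e i) + (y i + s * e i)) = (\<lambda>i. (x i + y i) + (t + s) * e i)"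
        by (auto simp: algebra_simps)
      ultimately have "h (\<lambda>i. x i + y i) (t + s) \<le> h x t + h y s" by (simp add: h_def algebra_simps)
      then show ?thesis using le[of "\<lambda>i. x i + y i" "t + s"] x y by simp
    qed
    then have "g (\<lambda>i. x i + y i) - h x t \<le> g y" for t by (intro ge) (simp add: algebra_simps)
    then have "g (\<lambda>i. x i + y i) - g y \<le> g x" by (intro ge) (simp add: algebra_simps)
    then show ?thesis by simp
  qed
  moreover have "g (\<lambda>i. c * x i) = c * g x" if x: "x \<in> Rn n" and c: "0 \<le> c" for x c
  proof (cases "c = 0")
    case True
    have "g (\<lambda>_. 0) \<le> 0" using le[of "\<lambda>_. 0" 0] sublinear_zero by (simp add: h_def)
    moreover have "0 \<le> g (\<lambda>_. 0)" using lower[of "\<lambda>_. 0"] sublinear_zero by (intro ge) simp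
    ultimately show ?thesis using True by simp
  next
    case False
    then have c: "0 < c" using c by simp
    have h: "h (\<lambda>i. c * x i) (c * t) = c * h x t" for t
      using sublinear_scale[of "\<lambda>i. x i + t * e i" c] x e c by (simp add: h_def algebra_simps)
    show ?thesis
    proof (rule antisym)
      have "g (\<lambda>i. c * x i) / c \<le> g x"
        using le[of "\<lambda>i. c * x i"] x c by (intro ge) (simp add: pos_divide_le_eq mult.commute flip: h)
      then show "g (\<lambda>i. c * x i) \<le> c * g x" using c by (simp add: pos_divide_le_eq mult.commute)
      show "c * g x \<le> g (\<lambda>i. c * x i)"
      proof (rule ge)
        fix t
        have "c * g x \<le> c * h x (t / c)" using le[OF x] c by simp
        also have "\<dots> = h (\<lambda>i. c * x i) t" using h[of "t / c"] c by simp
        finally show "c * g x \<le> h (\<lambda>i. c * x i) t" .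
      qed
    qed
  qed
  ultimately have "sublinear n g" by (simp add: sublinear_def)
  moreover have "g x \<le> f x" if "x \<in> Rn n" for x using le[OF that, of 0] by (simp add: h_def)
  moreover have "g (\<lambda>i. - e i) \<le> - f e"
    using le[of "\<lambda>i. - e i" 1] e sublinear_zero by (simp add: h_def)
  ultimately show thesis by (rule that)
qed

end

text \<open>A first minorant of \<open>N\<close> is taken along \<open>z\<close>, which fixes the
  value \<open>N z\<close> there. Further minorants along the basis vectors force linearity and
  cannot destroy what was gained, since all the conditions are upper bounds.\<close>

lemma ex_norming_functional:
  assumes N: "is_norm n N" and z: "z \<in> Rn n"
  obtains \<phi> where "\<phi> \<in> dual_ball n N" "\<phi> z = N z"
proof -
  have subN: "sublinear n N" using N by (auto simp: sublinear_def is_norm_def)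
  obtain f where f: "sublinear n f" "\<And>x. x \<in> Rn n \<Longrightarrow> f x \<le> N x" "f (\<lambda>i. - z i) \<le> - N z"
    using ex_sublinear_minorant[OF subN z] by blast
  have "\<exists>g. sublinear n g \<and> (\<forall>x\<in>Rn n. g x \<le> f x) \<and>
      (\<forall>i<k. g (\<lambda>j. if j = i then 1 else 0) + g (\<lambda>j. if j = i then - 1 else 0) \<le> 0)" if "k \<le> n" for k
    using that
  proof (induction k)
    case 0
    then show ?case using f by auto
  next
    case (Suc k)
    then obtain g where g: "sublinear n g" "\<And>x. x \<in> Rn n \<Longrightarrow> g x \<le> f x"
      "\<And>i. i < k \<Longrightarrow> g (\<lambda>j. if j = i then 1 else 0) + g (\<lambda>j. if j = i then - 1 else 0) \<le> 0" by auto
    let ?b = "\<lambda>i j. if j = i then 1 else 0 :: real"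
    let ?b' = "\<lambda>i j. if j = i then - 1 else 0 :: real"
    have b: "?b i \<in> Rn n" "?b' i \<in> Rn n" if "i < Suc k" for i using Suc.prems that by (auto simp: Rn_def)
    have neg: "(\<lambda>j. - ?b i j) = ?b' i" for i by (auto simp: fun_eq_iff)
    obtain h where h: "sublinear n h" "\<And>x. x \<in> Rn n \<Longrightarrow> h x \<le> g x" "h (\<lambda>j. - ?b k j) \<le> - g (?b k)"
      using ex_sublinear_minorant[OF g(1) b(1)[of k]] by auto
    have "h (?b i) + h (?b' i) \<le> 0" if "i < Suc k" for i
    proof (cases "i = k")
      case True
      then show ?thesis using h(2)[OF b(1)[OF that]] h(3) unfolding neg by simp
    next
      case False
      then have "i < k" using that by simp
      then show ?thesis using h(2)[OF b(1)[OF that]] h(2)[OF b(2)[OF that]] g(3)[of i] by simp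
    qed
    then show ?case using h(1) h(2) g(2) by (intro exI[of _ h]) force
  qed
  from this[of n] obtain g where g: "sublinear n g" "\<And>x. x \<in> Rn n \<Longrightarrow> g x \<le> f x"
    "\<And>i. i < n \<Longrightarrow> g (\<lambda>j. if j = i then 1 else 0) + g (\<lambda>j. if j = i then - 1 else 0) \<le> 0" by auto
  have lin: "linear_functional n g" by (rule linear_functional_if_odd_on_basis[OF g(1) g(3)])
  have gN: "g x \<le> N x" if "x \<in> Rn n" for x using g(2) f(2) that by (meson order_trans)
  have "\<bar>g x\<bar> \<le> 1" if x: "x \<in> unit_ball n N" for x
  proof -
    have xR: "x \<in> Rn n" and "N x \<le> 1" using x by (auto simp: unit_ball_def)
    moreover have "g (\<lambda>i. (- 1) * x i) = (- 1) * g x" using lin xR unfolding linear_functional_def by blast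
    moreover have "N (\<lambda>i. (- 1) * x i) = \<bar>- 1\<bar> * N x" using N xR unfolding is_norm_def by blast
    ultimately show ?thesis using gN[OF xR] gN[of "\<lambda>i. (- 1) * x i"] by (simp add: abs_le_iff)
  qed
  then have "g \<in> dual_ball n N" using lin by (auto simp: dual_ball_def)
  moreover have "g z = N z"
  \<comment> \<open>Here \<open>g (- z) \<le> f (- z) \<le> - N z\<close>, and sublinearity gives
    \<open>0 \<le> g z + g (- z)\<close>.\<close>
  proof (rule antisym[OF gN[OF z]])
    show "N z \<le> g z" using sublinear_neg[OF g(1) z] g(2)[of "\<lambda>i. - z i"] f(3) z by auto
  qed
  ultimately show thesis by (rule that)
qed

section \<open>Duality between weak norms of families and norms of their combinations\<close>

lemma linear_functional_zero:
  assumes "linear_functional n \<phi>"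
  shows "\<phi> (\<lambda>_. 0) = 0"
proof -
  have "\<forall>x\<in>Rn n. \<forall>c. \<phi> (\<lambda>i. c * x i) = c * \<phi> x" using assms by (simp add: linear_functional_def)
  from this[rule_format, OF Rn_closed(4), of 0] show ?thesis by simp
qed

lemma linear_functional_sum:
  fixes m :: nat
  assumes "linear_functional n \<phi>" "\<And>i. i < m \<Longrightarrow> x i \<in> Rn n"
  shows "(\<lambda>j. \<Sum>i<m. Y i * x i j) \<in> Rn n" "\<phi> (\<lambda>j. \<Sum>i<m. Y i * x i j) = (\<Sum>i<m. Y i * \<phi> (x i))"
proof -
  have "(\<lambda>j. \<Sum>i<m. Y i * x i j) \<in> Rn n \<and> \<phi> (\<lambda>j. \<Sum>i<m. Y i * x i j) = (\<Sum>i<m. Y i * \<phi> (x i))"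
    using assms(2)
  proof (induction m)
    case 0
    show ?case using linear_functional_zero[OF assms(1)] by simp
  next
    case (Suc m)
    have "\<phi> (\<lambda>j. (\<Sum>i<m. Y i * x i j) + Y m * x m j) = \<phi> (\<lambda>j. \<Sum>i<m. Y i * x i j) + \<phi> (\<lambda>j. Y m * x m j)"
      using assms(1) Suc by (simp add: linear_functional_def)
    moreover have "\<phi> (\<lambda>j. Y m * x m j) = Y m * \<phi> (x m)"
      using assms(1) Suc by (simp add: linear_functional_def)
    ultimately show ?case using Suc by simp
  qed
  then show "(\<lambda>j. \<Sum>i<m. Y i * x i j) \<in> Rn n" "\<phi> (\<lambda>j. \<Sum>i<m. Y i * x i j) = (\<Sum>i<m. Y i * \<phi> (x i))" by auto
qed

lemma abs_dual_ball_le: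
  assumes N: "is_norm n N" and \<phi>: "\<phi> \<in> dual_ball n N" and x: "x \<in> Rn n"
  shows "\<bar>\<phi> x\<bar> \<le> N x"
proof (cases "N x = 0")
  case True
  then have "x = (\<lambda>_. 0)" using N x by (auto simp: is_norm_def)
  then show ?thesis using linear_functional_zero[of n \<phi>] \<phi> True by (simp add: dual_ball_def)
next
  case False
  then have pos: "0 < N x" using N x by (auto simp: is_norm_def less_le)
  let ?y = "\<lambda>i. inverse (N x) * x i"
  have "N ?y = \<bar>inverse (N x)\<bar> * N x" using N x unfolding is_norm_def by blast
  then have "N ?y = 1" using pos by simp
  then have "\<bar>\<phi> ?y\<bar> \<le> 1" using \<phi> x by (auto simp: dual_ball_def unit_ball_def)
  moreover have "\<phi> ?y = inverse (N x) * \<phi> x" using \<phi> x by (auto simp: dual_ball_def linear_functional_def)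
  ultimately have "\<bar>inverse (N x) * \<phi> x\<bar> \<le> 1" by simp
  then have "\<bar>\<phi> x\<bar> / N x \<le> 1" using pos by (simp add: abs_mult divide_inverse mult.commute)
  then show ?thesis using pos by (simp add: pos_divide_le_eq)
qed

text \<open>The supremum on the right-hand side in \<open>pi2\<close>, known as the weak l2-norm of
  the family.\<close>

definition weak_norm :: "nat \<Rightarrow> ((nat \<Rightarrow> real) \<Rightarrow> real) \<Rightarrow> nat \<Rightarrow> (nat \<Rightarrow> nat \<Rightarrow> real) \<Rightarrow> real" where
  "weak_norm n N m x = (SUP \<phi>\<in>dual_ball n N. sqrt (\<Sum>i<m. \<bar>\<phi> (x i)\<bar>\<^sup>2))"

lemma weak_norm_upper:
  assumes "is_norm n N" "\<And>i. i < m \<Longrightarrow> x i \<in> Rn n" "\<phi> \<in> dual_ball n N"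
  shows "sqrt (\<Sum>i<m. \<bar>\<phi> (x i)\<bar>\<^sup>2) \<le> weak_norm n N m x"
  unfolding weak_norm_def using assms
  by (intro cSUP_upper bdd_aboveI2[of _ _ "sqrt (\<Sum>i<m. (N (x i))\<^sup>2)"] assms(3) real_sqrt_le_mono sum_mono power_mono
      abs_dual_ball_le) auto

lemma weak_norm_nonneg:
  assumes "is_norm n N" "\<And>i. i < m \<Longrightarrow> x i \<in> Rn n"
  shows "0 \<le> weak_norm n N m x"
proof -
  have "(\<lambda>_. 0) \<in> dual_ball n N" by (auto simp: dual_ball_def linear_functional_def)
  from weak_norm_upper[OF assms this] show ?thesis by simp
qed

text \<open>Apply a norming functional of the combination and then Cauchy-Schwarz. In operator
  terms, the map from Euclidean R^m to E given by the family has norm at most the weak norm.\<close>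

lemma norm_combination_le_weak_norm:
  assumes N: "is_norm n N" and x: "\<And>i. i < m \<Longrightarrow> x i \<in> Rn n"
  shows "N (\<lambda>j. \<Sum>i<m. Y i * x i j) \<le> weak_norm n N m x * sqrt (\<Sum>i<m. (Y i)\<^sup>2)"
proof -
  have "linear_functional n (\<lambda>_. 0)" by (simp add: linear_functional_def)
  then have "(\<lambda>j. \<Sum>i<m. Y i * x i j) \<in> Rn n" using x by (rule linear_functional_sum(1))
  then obtain \<phi> where \<phi>: "\<phi> \<in> dual_ball n N" "\<phi> (\<lambda>j. \<Sum>i<m. Y i * x i j) = N (\<lambda>j. \<Sum>i<m. Y i * x i j)"
    using ex_norming_functional[OF N] by blast
  have "linear_functional n \<phi>" using \<phi>(1) by (simp add: dual_ball_def)
  from linear_functional_sum(2)[of n \<phi> m x, OF this x]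
  have "N (\<lambda>j. \<Sum>i<m. Y i * x i j) = (\<Sum>i<m. Y i * \<phi> (x i))" using \<phi>(2) by simp
  also have "\<dots> \<le> (\<Sum>i<m. \<bar>Y i\<bar> * \<bar>\<phi> (x i)\<bar>)" by (intro sum_mono) (metis abs_ge_self abs_mult)
  also have "\<dots> \<le> L2_set Y {..<m} * L2_set (\<lambda>i. \<phi> (x i)) {..<m}" by (rule L2_set_mult_ineq)
  also have "\<dots> \<le> L2_set Y {..<m} * weak_norm n N m x"
    using weak_norm_upper[OF N x \<phi>(1)] by (intro mult_left_mono) (auto simp: L2_set_def sum_nonneg)
  finally show ?thesis by (simp add: L2_set_def mult.commute)
qed

text \<open>Dividing a family by its weak norm makes its combinations satisfy the premise of
  \<open>bound\<close>, so only families normalised in this way have to be tested.\<close>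

lemma pi2_id_powr_le:
  assumes N: "is_norm n N" and p: "0 < p" and c: "0 < c" and M: "0 \<le> M"
    and bound: "\<And>(m::nat) x. (\<And>i. i < m \<Longrightarrow> x i \<in> Rn n) \<Longrightarrow>
      (\<And>Y. N (\<lambda>j. \<Sum>i<m. Y i * x i j) \<le> sqrt (\<Sum>i<m. (Y i)\<^sup>2)) \<Longrightarrow>
      c * sqrt (\<Sum>i<m. (norm2 n (x i))\<^sup>2) powr p \<le> M"
  shows "c * pi2 n N (norm2 n) (\<lambda>x. x) powr p \<le> M"
proof -
  \<comment> \<open>The solution of \<open>c * C0 powr p = M\<close>; it is shown to be an
    admissible constant in \<open>pi2\<close>.\<close>
  define C0 where "C0 = (M / c) powr (1 / p)"
  let ?A = "{C. 0 \<le> C \<and> (\<forall>m x. (\<forall>i<m. x i \<in> Rn n) \<longrightarrow>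
      sqrt (\<Sum>i<m. (norm2 n (x i))\<^sup>2) \<le> C * weak_norm n N m x)}"
  have pi2: "pi2 n N (norm2 n) (\<lambda>x. x) = Inf ?A" by (simp add: pi2_def weak_norm_def)
  have "sqrt (\<Sum>i<m. (norm2 n (x i))\<^sup>2) \<le> C0 * weak_norm n N m x" if x: "\<forall>i<m. x i \<in> Rn n" for m x
  proof -
    let ?S = "weak_norm n N m x" and ?s = "sqrt (\<Sum>i<m. (norm2 n (x i))\<^sup>2)"
    have S: "0 \<le> ?S" using weak_norm_nonneg[OF N] x by auto
    have le: "N (\<lambda>j. \<Sum>i<m. Y i * x i j) \<le> ?S * sqrt (\<Sum>i<m. (Y i)\<^sup>2)" for Y
      using norm_combination_le_weak_norm[OF N] x by auto
    show ?thesis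
    proof (cases "?S = 0")
      \<comment> \<open>No rescaling is possible here, but coordinate vectors as coefficients show
        that the whole family vanishes.\<close>
      case True
      have "norm2 n (x k) = 0" if "k < m" for k
      proof -
        have "(\<lambda>j. \<Sum>i<m. (if i = k then 1 else 0) * x i j) = x k"
          using that by (auto simp: if_distrib[of "\<lambda>t. t * _"] cong: if_cong)
        then have "N (x k) \<le> 0" using le[of "\<lambda>i. if i = k then 1 else 0"] True by simp
        then have "x k = (\<lambda>_. 0)" using N x that by (auto simp: is_norm_def intro: antisym)
        then show ?thesis by (simp add: norm2_def L2_set_def)
      qed
      then show ?thesis using True by simp
    next
      case False
      then have S: "0 < ?S" using S by simp
      let ?x = "\<lambda>i j. inverse ?S * x i j"
      have "c * sqrt (\<Sum>i<m. (norm2 n (?x i))\<^sup>2) powr p \<le> M"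
      proof (rule bound[of m ?x])
        show "?x i \<in> Rn n" if "i < m" for i using x that by auto
        fix Y
        have "(\<lambda>j. \<Sum>i<m. Y i * ?x i j) = (\<lambda>j. \<Sum>i<m. (inverse ?S * Y i) * x i j)"
          by (auto simp: algebra_simps)
        then have "N (\<lambda>j. \<Sum>i<m. Y i * ?x i j) = N (\<lambda>j. \<Sum>i<m. (inverse ?S * Y i) * x i j)" by simp
        also have "\<dots> \<le> ?S * sqrt (\<Sum>i<m. (inverse ?S * Y i)\<^sup>2)" by (rule le)
        also have "\<dots> = sqrt (\<Sum>i<m. (Y i)\<^sup>2)"
          using S by (simp add: power_mult_distrib real_sqrt_mult flip: sum_distrib_left)
        finally show "N (\<lambda>j. \<Sum>i<m. Y i * ?x i j) \<le> sqrt (\<Sum>i<m. (Y i)\<^sup>2)" .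
      qed
      also have "sqrt (\<Sum>i<m. (norm2 n (?x i))\<^sup>2) = ?s / ?S"
        proof -
          have "norm2 n (?x i) = inverse ?S * norm2 n (x i)" for i
            unfolding norm2_def using S by (intro L2_set_right_distrib[symmetric]) auto
          then show ?thesis
            using S by (simp add: power_mult_distrib real_sqrt_mult divide_inverse flip: sum_distrib_left)
        qed
      finally have "(?s / ?S) powr p \<le> M / c" using c by (simp add: pos_le_divide_eq mult.commute)
      then have "((?s / ?S) powr p) powr (1 / p) \<le> C0" unfolding C0_def using p by (intro powr_mono2) auto
      moreover have "((?s / ?S) powr p) powr (1 / p) = ?s / ?S"
        using p S by (simp add: powr_powr sum_nonneg)
      ultimately show ?thesis using S by (simp add: pos_divide_le_eq)
    qed
  qed
  then have C0: "C0 \<in> ?A" by (auto simp: C0_def)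
  then have "Inf ?A \<le> C0" by (intro cInf_lower bdd_belowI[of _ 0]) auto
  moreover have "0 \<le> Inf ?A" using C0 by (intro cInf_greatest) blast+
  ultimately have "pi2 n N (norm2 n) (\<lambda>x. x) powr p \<le> C0 powr p"
    unfolding pi2 using p by (intro powr_mono2) auto
  also have "\<dots> = M / c" using p M c by (simp add: C0_def powr_powr)
  finally show ?thesis using c by (simp add: pos_le_divide_eq mult.commute)
qed

section \<open>Random signed sums\<close>

text \<open>All 2^k signed sums of k vectors, listed with repetitions, so that the uniform
  distribution on the list positions is the law of the random signed sum.\<close>

fun sign_sums :: "'a::ab_group_add list \<Rightarrow> 'a list" where
  "sign_sums [] = [0]"
| "sign_sums (w # ws) = map (\<lambda>x. x + w) (sign_sums ws) @ map (\<lambda>x. x - w) (sign_sums ws)"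

text \<open>The expectation of \<open>f\<close> at the sum of the vectors \<open>ws\<close> with
  independent uniform (Rademacher) signs.\<close>

definition rad :: "'a::ab_group_add list \<Rightarrow> ('a \<Rightarrow> real) \<Rightarrow> real" where
  "rad ws f = (\<Sum>x\<leftarrow>sign_sums ws. f x) / 2 ^ length ws"

lemma rad_Nil [simp]: "rad [] f = f 0"
  by (simp add: rad_def)

lemma rad_Cons [simp]: "rad (w # ws) f = (rad ws (\<lambda>x. f (x + w)) + rad ws (\<lambda>x. f (x - w))) / 2"
  by (simp add: rad_def o_def add_divide_distrib)

lemma rad_add: "rad ws (\<lambda>x. f x + g x) = rad ws f + rad ws g"
  by (simp add: rad_def sum_list_addf add_divide_distrib)

lemma rad_cmult: "rad ws (\<lambda>x. c * f x) = c * rad ws f"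
  by (simp add: rad_def sum_list_const_mult)

lemma rad_diff: "rad ws (\<lambda>x. f x - g x) = rad ws f - rad ws g"
  by (simp add: rad_def sum_list_subtractf diff_divide_distrib)

lemma rad_const [simp]: "rad ws (\<lambda>_. c) = c"
  by (induction ws) auto

lemma rad_mono: "(\<And>x. f x \<le> g x) \<Longrightarrow> rad ws f \<le> rad ws g"
  by (simp add: rad_def divide_right_mono sum_list_mono)

lemma rad_nonneg: "(\<And>x. 0 \<le> f x) \<Longrightarrow> 0 \<le> rad ws f"
  using rad_mono[of "\<lambda>_. 0" f ws] by simp

lemma abs_rad_le: "\<bar>rad ws f\<bar> \<le> rad ws (\<lambda>x. \<bar>f x\<bar>)"
proof -
  have "rad ws f \<le> rad ws (\<lambda>x. \<bar>f x\<bar>)" "rad ws (\<lambda>x. - 1 * \<bar>f x\<bar>) \<le> rad ws f"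
    by (intro rad_mono; simp)+
  then show ?thesis unfolding rad_cmult by simp
qed

lemma rad_sum: "finite I \<Longrightarrow> rad ws (\<lambda>x. \<Sum>i\<in>I. f i x) = (\<Sum>i\<in>I. rad ws (f i))"
  by (induction I rule: finite_induct) (simp_all add: rad_add)

lemma rad_cmult_right: "rad ws (\<lambda>x. f x * c) = rad ws f * c"
  using rad_cmult[of ws c f] by (simp add: mult.commute)

lemma rad_append: "rad (ws @ ws') f = rad ws (\<lambda>x. rad ws' (\<lambda>y. f (x + y)))"
proof (induction ws arbitrary: f)
  case (Cons w ws)
  show ?case
    by (simp add: Cons.IH algebra_simps)
qed simp

lemma rad_uminus: "rad ws (\<lambda>x. f (- x)) = rad ws f"
proof (induction ws arbitrary: f)
  case (Cons w ws)
  show ?case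
    using Cons.IH[of "\<lambda>x. f (x + w)"] Cons.IH[of "\<lambda>x. f (x - w)"] by (simp add: algebra_simps)
qed simp

section \<open>Moments of random signed sums\<close>

text \<open>Semi-inner products stated with the group structure alone, which is all that signed sums
  use. Cauchy-Schwarz enters the fourth moment bound.\<close>

locale pos_quadratic =
  fixes B :: "'a::ab_group_add \<Rightarrow> 'a \<Rightarrow> real"
  assumes add_left: "B (x + y) z = B x z + B y z"
    and sym: "B x y = B y x"
    and pos: "0 \<le> B x x"
    and cs: "(B x y)\<^sup>2 \<le> B x x * B y y"
begin

lemma minus_left: "B (x - y) z = B x z - B y z"
  using add_left[of "x - y" y z] by simp

lemma add_right: "B z (x + y) = B z x + B z y"
  using add_left sym by metis

lemma minus_right: "B z (x - y) = B z x - B z y"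
  using minus_left sym by metis

lemma zero_left [simp]: "B 0 x = 0"
  using add_left[of 0 0 x] by simp

lemma add_sq: "B (x + y) (x + y) = B x x + 2 * B x y + B y y"
  and diff_sq: "B (x - y) (x - y) = B x x - 2 * B x y + B y y"
  by (simp_all add: add_left add_right minus_left minus_right sym[of y x])

lemma rad_quadratic: "rad ws (\<lambda>x. B x x) = (\<Sum>w\<leftarrow>ws. B w w)"
proof (induction ws)
  case (Cons w ws)
  have "rad (w # ws) (\<lambda>x. B x x) = rad ws (\<lambda>x. 2 * B x x + 2 * B w w) / 2"
    by (simp add: add_sq diff_sq flip: rad_add)
  also have "\<dots> = rad ws (\<lambda>x. B x x) + B w w"
    by (simp add: rad_add rad_cmult)
  finally show ?case using Cons by simp
qed simp

text \<open>A Khintchine inequality for fourth moments. Adding one vector creates the cross term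
  \<open>2 * B w w * B x x + 4 * (B x w)\<^sup>2\<close>, at most \<open>6 * B w w * B x x\<close>
  by Cauchy-Schwarz, and 6 is the cross coefficient of 3 (a + b)^2.\<close>

lemma rad_quadratic_squared_le: "rad ws (\<lambda>x. (B x x)\<^sup>2) \<le> 3 * (\<Sum>w\<leftarrow>ws. B w w)\<^sup>2"
proof (induction ws)
  case (Cons w ws)
  let ?a = "\<Sum>w\<leftarrow>ws. B w w"
  have step: "((B (x + w) (x + w))\<^sup>2 + (B (x - w) (x - w))\<^sup>2) / 2
      \<le> (B x x)\<^sup>2 + 6 * B w w * B x x + (B w w)\<^sup>2" for x
  proof -
    have "((B (x + w) (x + w))\<^sup>2 + (B (x - w) (x - w))\<^sup>2) / 2
        = (B x x)\<^sup>2 + 2 * B w w * B x x + (B w w)\<^sup>2 + 4 * (B x w)\<^sup>2"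
      unfolding add_sq diff_sq by (simp add: power2_eq_square algebra_simps)
    then show ?thesis using cs[of x w] by (simp add: mult.commute)
  qed
  have "rad (w # ws) (\<lambda>x. (B x x)\<^sup>2) = rad ws (\<lambda>x. ((B (x + w) (x + w))\<^sup>2 + (B (x - w) (x - w))\<^sup>2) / 2)"
    using rad_cmult[of ws "1/2" "\<lambda>x. (B (x + w) (x + w))\<^sup>2 + (B (x - w) (x - w))\<^sup>2"] by (simp add: rad_add)
  also have "\<dots> \<le> rad ws (\<lambda>x. (B x x)\<^sup>2 + 6 * B w w * B x x + (B w w)\<^sup>2)"
    using step by (rule rad_mono)
  also have "\<dots> = rad ws (\<lambda>x. (B x x)\<^sup>2) + 6 * B w w * ?a + (B w w)\<^sup>2"
    by (simp add: rad_add rad_cmult rad_quadratic)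
  also have "\<dots> \<le> 3 * ?a\<^sup>2 + 6 * B w w * ?a + 3 * (B w w)\<^sup>2"
    by (intro add_mono order_refl Cons.IH) simp
  also have "\<dots> = 3 * (\<Sum>w\<leftarrow>w # ws. B w w)\<^sup>2"
    by (simp add: power2_eq_square algebra_simps)
  finally show ?case .
qed simp

text \<open>The lower bound is the second moment method, in the form \<open>t\<^sup>q \<ge> t - t\<^sup>2/4\<close>.\<close>

lemma rad_quadratic_powr_bounds:
  assumes q: "0 < q" "q < 1" and a: "a = (\<Sum>w\<leftarrow>ws. B w w)" "0 < a"
  shows "a powr q / 4 \<le> rad ws (\<lambda>x. B x x powr q)" "rad ws (\<lambda>x. B x x powr q) \<le> 2 * a powr q"
proof -
  \<comment> \<open>To be used at \<open>t = B x x / a\<close>, which has mean 1 and second moment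
    at most 3; this yields the factors 1 - 3/4 below and 1 + 1 above. For t > 1 the lower bound
    holds because t - t^2/4 \<le> 1.\<close>
  have t: "t - t\<^sup>2 / 4 \<le> t powr q \<and> t powr q \<le> 1 + t" if "0 \<le> t" for t :: real
  proof (cases "t \<le> 1")
    case True
    have "t powr 1 \<le> t powr q" if "t > 0" using True that q by (intro powr_mono') auto
    then have "t \<le> t powr q" using \<open>0 \<le> t\<close> by (cases "t = 0") auto
    moreover have "t powr q \<le> 1 powr q" using True that q by (intro powr_mono2) auto
    ultimately show ?thesis
      using \<open>0 \<le> t\<close> zero_le_power2[of t] unfolding powr_one_eq_one by - (rule conjI; linarith)
  next
    case False
    have "t powr q \<le> t powr 1" using False q by (intro powr_mono) auto
    moreover have "1 \<le> t powr q" using False q by (intro ge_one_powr_ge_zero) auto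
    moreover have "0 \<le> (t / 2 - 1)\<^sup>2" by simp
    ultimately show ?thesis using False by (simp add: power2_eq_square algebra_simps)
  qed
  have eq: "B x x powr q = a powr q * (B x x / a) powr q" for x
    using pos[of x] a by (simp add: powr_divide)
  have "a powr q * (1 - 3 / 4) \<le> a powr q * (rad ws (\<lambda>x. B x x) / a - rad ws (\<lambda>x. (B x x)\<^sup>2) / (4 * a\<^sup>2))"
    using rad_quadratic_squared_le[of ws] a(2)
    by (intro mult_left_mono) (auto simp: rad_quadratic divide_le_eq simp flip: a(1))
  also have "\<dots> = rad ws (\<lambda>x. a powr q * (1 / a * B x x - 1 / (4 * a\<^sup>2) * (B x x)\<^sup>2))"
    by (simp only: rad_cmult rad_diff) simp
  also have "\<dots> \<le> rad ws (\<lambda>x. B x x powr q)"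
  proof (rule rad_mono)
    fix x
    have "1 / a * B x x - 1 / (4 * a\<^sup>2) * (B x x)\<^sup>2 = B x x / a - (B x x / a)\<^sup>2 / 4"
      by (simp add: power_divide)
    also have "\<dots> \<le> (B x x / a) powr q" using t[of "B x x / a"] pos[of x] a(2) by simp
    finally show "a powr q * (1 / a * B x x - 1 / (4 * a\<^sup>2) * (B x x)\<^sup>2) \<le> B x x powr q"
      unfolding eq by (rule mult_left_mono) simp
  qed
  finally show "a powr q / 4 \<le> rad ws (\<lambda>x. B x x powr q)" by simp
  have "rad ws (\<lambda>x. B x x powr q) \<le> rad ws (\<lambda>x. a powr q * (1 + 1 / a * B x x))"
    unfolding eq using t pos a(2) by (intro rad_mono mult_left_mono) auto
  also have "\<dots> = 2 * a powr q"
    using a by (simp only: rad_cmult rad_add rad_const rad_quadratic) simp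
  finally show "rad ws (\<lambda>x. B x x powr q) \<le> 2 * a powr q" .
qed

end

section \<open>Exponential moments\<close>

text \<open>Quadratic bounds for both exponentials suffice on [0, 1]; beyond 1, cosh y \<le> exp y
  \<le> exp (y^2).\<close>

lemma cosh_le_exp_square: "(exp y + exp (- y)) / 2 \<le> exp (y\<^sup>2)" for y :: real
proof -
  have "(exp y + exp (- y)) / 2 \<le> exp (y\<^sup>2)" if "0 \<le> y" for y :: real
  proof (cases "y \<le> 1")
    case True
    have "exp y \<le> 1 + y + y\<^sup>2" using True that by (intro exp_bound) auto
    moreover have "exp (- y) \<le> 1 - y + y\<^sup>2"
    proof -
      \<comment> \<open>The product is 1 + y^3.\<close>
      have "1 \<le> (1 - y + y\<^sup>2) * (1 + y)" using that by (simp add: power2_eq_square algebra_simps)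
      also have "\<dots> \<le> (1 - y + y\<^sup>2) * exp y"
        using True by (intro mult_left_mono) (auto simp: add_increasing2)
      finally show ?thesis by (simp add: exp_minus field_simps)
    qed
    ultimately have "(exp y + exp (- y)) / 2 \<le> ((1 + y + y\<^sup>2) + (1 - y + y\<^sup>2)) / 2"
      by (intro divide_right_mono add_mono) auto
    also have "\<dots> = 1 + y\<^sup>2" by simp
    also have "\<dots> \<le> exp (y\<^sup>2)" by (rule exp_ge_add_one_self)
    finally show ?thesis .
  next
    case False
    then have "exp (- y) \<le> exp y" "y \<le> y\<^sup>2" by (auto simp: power2_eq_square)
    then have "(exp y + exp (- y)) / 2 \<le> exp y" "exp y \<le> exp (y\<^sup>2)" by auto
    then show ?thesis by linarith
  qed
  from this[of y] this[of "- y"] show ?thesis by (cases "0 \<le> y") (auto simp: add.commute)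
qed

section \<open>Exponential moments of the squared length of a sum of sign vectors\<close>

definition sqnorm :: "nat \<Rightarrow> (nat \<Rightarrow> real) \<Rightarrow> real" where
  "sqnorm m x = (\<Sum>i<m. (x i)\<^sup>2)"

definition unit_vec :: "nat \<Rightarrow> nat \<Rightarrow> real" where
  "unit_vec i j = (if j = i then 1 else 0)"

lemma sqnorm_nonneg [simp]: "0 \<le> sqnorm m x"
  by (simp add: sqnorm_def sum_nonneg)

lemma sqnorm_unit_vec:
  assumes "i < m"
  shows "sqnorm m (x + unit_vec i) = sqnorm m x + 2 * x i + 1"
    and "sqnorm m (x - unit_vec i) = sqnorm m x - 2 * x i + 1"
  using assms
  by (simp_all add: sqnorm_def unit_vec_def sum.remove[of "{..<m}" i] power2_eq_square algebra_simps)

text \<open>A sign on coordinate i changes the squared norm by 1 + 2 x_i or 1 - 2 x_i, and averaging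
  exp (2 b x_i) and exp (- 2 b x_i) costs at most exp (4 b^2 x_i^2). As the indices are distinct,
  each x_i is still the original one when its turn comes.\<close>

lemma rad_unit_vecs_exp_le:
  assumes "distinct is" "set is \<subseteq> {..<m}" "0 \<le> b"
  shows "rad (map unit_vec is) (\<lambda>y. exp (b * sqnorm m (x + y)))
    \<le> exp (b * sqnorm m x + b * length is + 4 * b\<^sup>2 * (\<Sum>i\<in>set is. (x i)\<^sup>2))"
  using assms(1,2)
proof (induction "is" arbitrary: x)
  case Nil
  then show ?case by simp
next
  case (Cons i js)
  let ?c = "b * sqnorm m x + b + b * length js + 4 * b\<^sup>2 * (\<Sum>j\<in>set js. (x j)\<^sup>2)"
  have i: "i < m" "i \<notin> set js" using Cons.prems by auto
  have eq: "(\<Sum>j\<in>set js. ((x + unit_vec i) j)\<^sup>2) = (\<Sum>j\<in>set js. (x j)\<^sup>2)"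
    "(\<Sum>j\<in>set js. ((x - unit_vec i) j)\<^sup>2) = (\<Sum>j\<in>set js. (x j)\<^sup>2)"
    using i by (auto intro!: sum.cong simp: unit_vec_def)
  have js: "distinct js" "set js \<subseteq> {..<m}" using Cons.prems by auto
  have plus: "rad (map unit_vec js) (\<lambda>y. exp (b * sqnorm m ((x + unit_vec i) + y))) \<le> exp ?c * exp (2 * b * x i)"
    using Cons.IH[OF js, of "x + unit_vec i"] unfolding eq sqnorm_unit_vec[OF i(1)] exp_add[symmetric]
    by (rule order_trans) (simp add: algebra_simps)
  have minus: "rad (map unit_vec js) (\<lambda>y. exp (b * sqnorm m ((x - unit_vec i) + y))) \<le> exp ?c * exp (- (2 * b * x i))"
    using Cons.IH[OF js, of "x - unit_vec i"] unfolding eq sqnorm_unit_vec[OF i(1)] exp_add[symmetric]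
    by (rule order_trans) (simp add: algebra_simps)
  have "x + (y + unit_vec i) = (x + unit_vec i) + y" "x + (y - unit_vec i) = (x - unit_vec i) + y" for y
    by (auto simp: fun_eq_iff)
  then have "rad (map unit_vec (i # js)) (\<lambda>y. exp (b * sqnorm m (x + y)))
      \<le> (exp ?c * exp (2 * b * x i) + exp ?c * exp (- (2 * b * x i))) / 2"
    using plus minus by (simp only: list.map rad_Cons) (intro divide_right_mono add_mono, auto)
  also have "\<dots> = exp ?c * ((exp (2 * b * x i) + exp (- (2 * b * x i))) / 2)"
    by (simp add: distrib_left)
  also have "\<dots> \<le> exp ?c * exp ((2 * b * x i)\<^sup>2)"
    by (intro mult_left_mono cosh_le_exp_square) auto
  also have "\<dots> = exp (b * sqnorm m x + b * length (i # js) + 4 * b\<^sup>2 * (\<Sum>i\<in>set (i # js). (x i)\<^sup>2))"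
    using i by (simp add: power_mult_distrib algebra_simps flip: exp_add)
  finally show ?case .
qed

text \<open>\<open>K\<close> copies of the standard basis of R^m: the random signed sum is the sum
  of \<open>K\<close> independent uniform sign vectors.\<close>

fun rounds :: "nat \<Rightarrow> nat \<Rightarrow> (nat \<Rightarrow> real) list" where
  "rounds m 0 = []"
| "rounds m (Suc K) = rounds m K @ map unit_vec [0..<m]"

lemma rounds_add: "rounds m (K + L) = rounds m K @ rounds m L"
  by (induction L) auto

lemma sum_list_rounds: "(\<Sum>w\<leftarrow>rounds m K. f w) = real K * (\<Sum>i<m. f (unit_vec i))"
  by (induction K) (simp_all add: interv_sum_list_conv_sum_set_nat atLeast0LessThan distrib_right o_def)

text \<open>Integrating out one round costs exp (b m) and replaces b by b + 4 b^2, which lowers 1/b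
  by at most 4. The assumption budgets for \<open>K\<close> such losses, so the rate never exceeds
  \<beta> and every round costs at most exp (\<beta> m).\<close>

lemma rad_rounds_exp_le_aux:
  assumes "0 < b" "0 < \<beta>" "1 / \<beta> + 4 * real K \<le> 1 / b"
  shows "rad (rounds m K) (\<lambda>y. exp (b * sqnorm m y)) \<le> exp (\<beta> * real K * m)"
  using assms(1,3)
proof (induction K arbitrary: b)
  case 0
  then show ?case by (simp add: sqnorm_def)
next
  case (Suc K)
  let ?b = "b + 4 * b\<^sup>2"
  have "1 / \<beta> \<le> 1 / b" using Suc.prems by (smt (verit) of_nat_0_le_iff)
  then have "b \<le> \<beta>" using Suc.prems assms(2) by (simp add: field_simps)
  have b: "0 < ?b" using Suc.prems by (simp add: add_pos_nonneg)
  have "(1 / b - 4) * ?b = 1 - 16 * b\<^sup>2"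
    using Suc.prems by (simp add: field_simps power2_eq_square)
  then have "1 / b - 4 \<le> 1 / ?b" using b by (simp add: pos_le_divide_eq)
  then have "1 / \<beta> + 4 * real K \<le> 1 / ?b" using Suc.prems by (simp add: algebra_simps)
  note IH = Suc.IH[OF b this]
  have "rad (rounds m (Suc K)) (\<lambda>y. exp (b * sqnorm m y))
      = rad (rounds m K) (\<lambda>x. rad (map unit_vec [0..<m]) (\<lambda>y. exp (b * sqnorm m (x + y))))"
    by (simp add: rad_append)
  also have "\<dots> \<le> rad (rounds m K) (\<lambda>x. exp (b * m) * exp (?b * sqnorm m x))"
  proof (rule rad_mono)
    fix x
    have "rad (map unit_vec [0..<m]) (\<lambda>y. exp (b * sqnorm m (x + y)))
        \<le> exp (b * sqnorm m x + b * length [0..<m] + 4 * b\<^sup>2 * (\<Sum>i\<in>set [0..<m]. (x i)\<^sup>2))"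
      using Suc.prems by (intro rad_unit_vecs_exp_le) auto
    also have "\<dots> = exp (b * m) * exp (?b * sqnorm m x)"
      by (simp add: sqnorm_def atLeast0LessThan algebra_simps flip: exp_add)
    finally show "rad (map unit_vec [0..<m]) (\<lambda>y. exp (b * sqnorm m (x + y)))
        \<le> exp (b * m) * exp (?b * sqnorm m x)" .
  qed
  also have "\<dots> \<le> exp (\<beta> * m) * exp (\<beta> * real K * m)"
    unfolding rad_cmult using IH \<open>b \<le> \<beta>\<close> by (intro mult_mono rad_nonneg) (auto intro: mult_right_mono)
  also have "\<dots> = exp (\<beta> * real (Suc K) * m)" by (simp add: algebra_simps flip: exp_add)
  finally show ?case .
qed

text \<open>The case \<beta> = 2 b, in which the budget 1/(2 b) + 4 K \<le> 1/b becomes 8 b K \<le>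
  1.\<close>

lemma rad_rounds_exp_le:
  assumes "0 < b" "8 * b * real K \<le> 1"
  shows "rad (rounds m K) (\<lambda>y. exp (b * sqnorm m y)) \<le> exp (2 * b * real K * m)"
  using assms by (intro rad_rounds_exp_le_aux) (auto simp: field_simps)

section \<open>Means that are almost invariant under dilations\<close>

text \<open>A normalised positive linear functional on sequences. Positivity refers to indices
  \<open>L \<ge> 1\<close> only, the positive integers on which the dilations act.\<close>

definition is_mean :: "((nat \<Rightarrow> real) \<Rightarrow> real) \<Rightarrow> bool" where
  "is_mean \<mu> \<longleftrightarrow>
     (\<forall>f g. \<mu> (\<lambda>L. f L + g L) = \<mu> f + \<mu> g) \<and> (\<forall>c f. \<mu> (\<lambda>L. c * f L) = c * \<mu> f) \<and>
     (\<forall>f g. (\<forall>L\<ge>1. f L \<le> g L) \<longrightarrow> \<mu> f \<le> \<mu> g) \<and> \<mu> (\<lambda>_. 1) = 1"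

context
  fixes \<mu>
  assumes mean: "is_mean \<mu>"
begin

lemma mean_add: "\<mu> (\<lambda>L. f L + g L) = \<mu> f + \<mu> g"
  and mean_cmult: "\<mu> (\<lambda>L. c * f L) = c * \<mu> f"
  and mean_mono: "(\<And>L. 1 \<le> L \<Longrightarrow> f L \<le> g L) \<Longrightarrow> \<mu> f \<le> \<mu> g"
  and mean_one: "\<mu> (\<lambda>_. 1) = 1"
  using mean by (auto simp: is_mean_def)

lemma mean_const: "\<mu> (\<lambda>_. c) = c"
  using mean_cmult[of c "\<lambda>_. 1"] mean_one by simp

lemma mean_sum: "finite I \<Longrightarrow> \<mu> (\<lambda>L. \<Sum>i\<in>I. f i L) = (\<Sum>i\<in>I. \<mu> (f i))"
  by (induction I rule: finite_induct) (simp_all add: mean_const mean_add)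

lemma abs_mean_le:
  assumes "\<And>L. 1 \<le> L \<Longrightarrow> \<bar>f L\<bar> \<le> c"
  shows "\<bar>\<mu> f\<bar> \<le> c"
proof -
  have "\<mu> f \<le> \<mu> (\<lambda>_. c)" "\<mu> (\<lambda>_. - c) \<le> \<mu> f"
    by (intro mean_mono; use assms in \<open>fastforce simp: abs_le_iff\<close>)+
  then show ?thesis by (simp add: mean_const abs_le_iff)
qed

end

text \<open>
  The mean for \<open>{1..Suc J}\<close> is the one for \<open>{1..J}\<close> averaged over the dilations by the first
  \<open>R\<close> powers of \<open>Suc J\<close>; multiplicative translations commute, so nothing is lost.
\<close>

lemma ex_dilation_invariant_mean:
  assumes "0 < \<epsilon>"
  obtains \<mu> where "is_mean \<mu>"
    "\<And>j H c. 1 \<le> j \<Longrightarrow> j \<le> J \<Longrightarrow> (\<And>L. 1 \<le> L \<Longrightarrow> \<bar>H L\<bar> \<le> c) \<Longrightarrow> \<bar>\<mu> (\<lambda>L. H (j * L)) - \<mu> H\<bar> \<le> \<epsilon> * c"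
proof -
  have "\<exists>\<mu>. is_mean \<mu> \<and> (\<forall>j H c. 1 \<le> j \<longrightarrow> j \<le> J \<longrightarrow> (\<forall>L\<ge>1. \<bar>H L\<bar> \<le> c) \<longrightarrow>
      \<bar>\<mu> (\<lambda>L. H (j * L)) - \<mu> H\<bar> \<le> \<epsilon> * c)"
  proof (induction J)
    case 0
    have "is_mean (\<lambda>H. H 1)" by (auto simp: is_mean_def)
    then show ?case by auto
  next
    case (Suc J)
    then obtain \<mu> where \<mu>: "is_mean \<mu>"
      and inv: "\<And>j H c. 1 \<le> j \<Longrightarrow> j \<le> J \<Longrightarrow> (\<And>L. 1 \<le> L \<Longrightarrow> \<bar>H L\<bar> \<le> c) \<Longrightarrow> \<bar>\<mu> (\<lambda>L. H (j * L)) - \<mu> H\<bar> \<le> \<epsilon> * c"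
      by (auto simp del: One_nat_def)
    \<comment> \<open>The telescoping sum below leaves two terms of modulus at most
      \<open>c\<close>, and 2 c / R has to stay below \<epsilon> c.\<close>
    obtain R :: nat where R: "2 / \<epsilon> < real R" using reals_Archimedean2 by blast
    have "0 < 2 / \<epsilon>" using assms by simp
    then have "0 < real R" using R by (rule less_trans)
    then have R0: "0 < R" by simp
    have R2: "2 \<le> \<epsilon> * real R" using R assms by (simp add: pos_divide_less_eq mult.commute)
    define t where "t = Suc J"
    define \<nu> where "\<nu> H = (\<Sum>e<R. \<mu> (\<lambda>L. H (t ^ e * L))) / real R" for H
    have t1: "1 \<le> t ^ e * L" if "1 \<le> L" for e L using that by (simp add: t_def)
    have "is_mean \<nu>"
      unfolding is_mean_def
    proof (intro conjI allI impI)
      show "\<nu> (\<lambda>L. f L + g L) = \<nu> f + \<nu> g" for f g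
        by (simp add: \<nu>_def mean_add[OF \<mu>] sum.distrib add_divide_distrib)
      show "\<nu> (\<lambda>L. c * f L) = c * \<nu> f" for c f
        by (simp add: \<nu>_def mean_cmult[OF \<mu>] flip: sum_distrib_left)
      show "\<nu> (\<lambda>_. 1) = 1" using R0 by (simp add: \<nu>_def mean_one[OF \<mu>])
      show "\<nu> f \<le> \<nu> g" if "\<forall>L\<ge>1. f L \<le> g L" for f g
        unfolding \<nu>_def using that t1 by (intro divide_right_mono sum_mono mean_mono[OF \<mu>]) auto
    qed
    moreover have "\<bar>\<nu> (\<lambda>L. H (j * L)) - \<nu> H\<bar> \<le> \<epsilon> * c"
      if j: "1 \<le> j" "j \<le> Suc J" and H: "\<forall>L\<ge>1. \<bar>H L\<bar> \<le> c" for j H c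
    proof -
      let ?f = "\<lambda>e. \<mu> (\<lambda>L. H (t ^ e * L))"
      have c: "0 \<le> c" using H by (meson abs_ge_zero order_refl order_trans)
      have diff: "\<nu> (\<lambda>L. H (j * L)) - \<nu> H = (\<Sum>e<R. \<mu> (\<lambda>L. H (j * (t ^ e * L))) - ?f e) / real R"
        by (simp add: \<nu>_def sum_subtractf diff_divide_distrib)
      have "\<bar>\<Sum>e<R. \<mu> (\<lambda>L. H (j * (t ^ e * L))) - ?f e\<bar> \<le> \<epsilon> * c * real R"
      proof (cases "j = t")
        case True
        have "(\<Sum>e<R. \<mu> (\<lambda>L. H (j * (t ^ e * L))) - ?f e) = (\<Sum>e<R. ?f (Suc e) - ?f e)"
          by (simp add: True mult.assoc)
        also have "\<dots> = ?f R - ?f 0" by (rule sum_lessThan_telescope)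
        also have "\<bar>\<dots>\<bar> \<le> c + c"
          using abs_mean_le[OF \<mu>, of "\<lambda>L. H (t ^ R * L)" c] abs_mean_le[OF \<mu>, of "\<lambda>L. H (t ^ 0 * L)" c] H t1
          by (intro order_trans[OF abs_triangle_ineq4 add_mono]) auto
        also have "\<dots> \<le> \<epsilon> * c * real R" using mult_right_mono[OF R2 c] by (simp add: algebra_simps)
        finally show ?thesis .
      next
        \<comment> \<open>Every dilate of \<open>H\<close> by a power of \<open>t\<close> is again
          bounded by \<open>c\<close>, so the old mean handles each summand once \<open>j\<close>
          and the power are commuted.\<close>
        case False
        then have "j \<le> J" using j by (simp add: t_def)
        then have "\<bar>\<mu> (\<lambda>L. H (t ^ e * (j * L))) - ?f e\<bar> \<le> \<epsilon> * c" for e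
          using H t1 j(1) by (intro inv) auto
        then have "\<bar>\<mu> (\<lambda>L. H (j * (t ^ e * L))) - ?f e\<bar> \<le> \<epsilon> * c" for e
          by (simp add: mult.left_commute)
        then have "(\<Sum>e<R. \<bar>\<mu> (\<lambda>L. H (j * (t ^ e * L))) - ?f e\<bar>) \<le> (\<Sum>e<R. \<epsilon> * c)"
          by (rule sum_mono)
        then show ?thesis by (intro order_trans[OF sum_abs]) (simp add: mult.commute)
      qed
      then show ?thesis unfolding diff using R0 by (simp add: abs_divide pos_divide_le_eq)
    qed
    ultimately show ?case by (intro exI[of _ \<nu>]) (simp add: t_def)
  qed
  then obtain \<mu> where "is_mean \<mu>" "\<forall>j H c. 1 \<le> j \<longrightarrow> j \<le> J \<longrightarrow> (\<forall>L\<ge>1. \<bar>H L\<bar> \<le> c) \<longrightarrow>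
      \<bar>\<mu> (\<lambda>L. H (j * L)) - \<mu> H\<bar> \<le> \<epsilon> * c" by blast
  then show thesis by (intro that[of \<mu>]) (simp_all del: One_nat_def)
qed

text \<open>The weights may have either sign, so the two-sided bounds on \<open>G\<close> do not
  control the sum for a single \<open>L\<close>. Under an almost invariant mean, however, all
  dilates of \<open>G\<close> have nearly the same value, at least \<open>g0\<close>, and some
  \<open>L\<close> does as well as the mean.\<close>

lemma ex_dilation_sum_ge:
  fixes w G :: "nat \<Rightarrow> real"
  assumes G: "\<And>K. 1 \<le> K \<Longrightarrow> g0 \<le> G K" "\<And>K. 1 \<le> K \<Longrightarrow> G K \<le> g1" and g0: "0 < g0"
    and w: "0 < (\<Sum>j=1..J. w j)"
  obtains L where "1 \<le> L" "g0 * (\<Sum>j=1..J. w j) / 2 \<le> (\<Sum>j=1..J. w j * G (j * L))"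
proof (rule ccontr)
  note witness = that
  assume no: "\<not> thesis"
  have less: "(\<Sum>j=1..J. w j * G (j * L)) \<le> g0 * (\<Sum>j=1..J. w j) / 2" if "1 \<le> L" for L
    using witness[OF that] no by linarith
  let ?B = "\<Sum>j=1..J. w j" and ?W = "\<Sum>j=1..J. \<bar>w j\<bar>"
  have "?B \<le> ?W" by (rule sum_mono) simp
  then have W: "0 < ?W" using w by simp
  have g1: "0 < g1" using G[of 1] g0 by simp
  \<comment> \<open>The total error \<open>\<epsilon> * g1 * ?W\<close> is then a quarter of
    \<open>g0 * ?B\<close>, less than the half given away in the claim.\<close>
  define \<epsilon> where "\<epsilon> = g0 * ?B / (4 * g1 * ?W)"
  have \<epsilon>: "0 < \<epsilon>" using w W g1 g0 by (simp add: \<epsilon>_def)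
  obtain \<mu> where \<mu>: "is_mean \<mu>" and inv: "\<And>j H c. 1 \<le> j \<Longrightarrow> j \<le> J \<Longrightarrow> (\<And>L. 1 \<le> L \<Longrightarrow> \<bar>H L\<bar> \<le> c) \<Longrightarrow>
      \<bar>\<mu> (\<lambda>L. H (j * L)) - \<mu> H\<bar> \<le> \<epsilon> * c"
    using ex_dilation_invariant_mean[OF \<epsilon>] by blast
  have "g0 \<le> \<mu> G" using mean_mono[OF \<mu>, of "\<lambda>_. g0" G] G by (simp add: mean_const[OF \<mu>])
  then have "g0 * ?B - \<epsilon> * g1 * ?W \<le> \<mu> G * ?B - \<epsilon> * g1 * ?W" using w by simp
  also have "\<dots> = (\<Sum>j=1..J. w j * \<mu> G - \<bar>w j\<bar> * (\<epsilon> * g1))"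
    by (simp add: sum_subtractf sum_distrib_left sum_distrib_right mult_ac)
  also have "\<dots> \<le> (\<Sum>j=1..J. w j * \<mu> (\<lambda>L. G (j * L)))"
  proof (rule sum_mono)
    fix j assume j: "j \<in> {1..J}"
    have "\<bar>\<mu> (\<lambda>L. G (j * L)) - \<mu> G\<bar> \<le> \<epsilon> * g1"
      using j G g0 by (intro inv) (force simp: abs_le_iff)+
    then have "\<bar>w j\<bar> * \<bar>\<mu> (\<lambda>L. G (j * L)) - \<mu> G\<bar> \<le> \<bar>w j\<bar> * (\<epsilon> * g1)" by (rule mult_left_mono) simp
    moreover have "w j * \<mu> G - w j * \<mu> (\<lambda>L. G (j * L)) \<le> \<bar>w j\<bar> * \<bar>\<mu> (\<lambda>L. G (j * L)) - \<mu> G\<bar>"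
      unfolding abs_mult[symmetric] right_diff_distrib by linarith
    ultimately show "w j * \<mu> G - \<bar>w j\<bar> * (\<epsilon> * g1) \<le> w j * \<mu> (\<lambda>L. G (j * L))" by linarith
  qed
  also have "\<dots> = \<mu> (\<lambda>L. \<Sum>j=1..J. w j * G (j * L))"
    by (simp add: mean_sum[OF \<mu>] mean_cmult[OF \<mu>])
  also have "\<dots> \<le> \<mu> (\<lambda>_. g0 * ?B / 2)" using less by (rule mean_mono[OF \<mu>])
  also have "\<dots> = g0 * ?B / 2" by (rule mean_const[OF \<mu>])
  finally have "g0 * ?B - \<epsilon> * g1 * ?W \<le> g0 * ?B / 2" .
  moreover have "\<epsilon> * g1 * ?W = g0 * ?B / 4" using W g1 by (simp add: \<epsilon>_def)
  moreover have "0 < g0 * ?B" using g0 w by simp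
  ultimately show False by linarith
qed

section \<open>Chebyshev polynomials\<close>

fun cheb :: "nat \<Rightarrow> real poly" where
  "cheb 0 = 1"
| "cheb (Suc 0) = [:0, 1:]"
| "cheb (Suc (Suc m)) = [:0, 2:] * cheb (Suc m) - cheb m"

lemma poly_cheb_cos: "poly (cheb m) (cos t) = cos (real m * t)"
proof (induction m rule: cheb.induct)
  case (3 m)
  have "cos (real (Suc (Suc m)) * t) + cos (real m * t) = 2 * cos t * cos (real (Suc m) * t)"
    using cos_add[of "real (Suc m) * t" t] cos_diff[of "real (Suc m) * t" t]
    by (simp add: algebra_simps)
  then show ?case using 3 by (simp add: algebra_simps)
qed auto

lemma poly_cheb_one: "poly (cheb m) 1 = 1"
  using poly_cheb_cos[of m 0] by simp

lemma degree_cheb_le: "degree (cheb m) \<le> m"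
proof (induction m rule: cheb.induct)
  case (3 m)
  have "degree ([:0, 2:] * cheb (Suc m)) \<le> 1 + Suc m"
    using 3 by (intro order_trans[OF degree_mult_le] add_mono) auto
  then show ?case using 3 by (auto intro!: degree_diff_le)
qed auto

text \<open>Multiplication by x only shifts coefficients, so the recursion gives 2 * 3^(m+1) + 3^m =
  7 * 3^m \<le> 3^(m+2). This controls the total variation of the signed measure.\<close>

lemma sum_abs_coeff_cheb_le: "(\<Sum>i\<le>k. \<bar>coeff (cheb m) i\<bar>) \<le> 3 ^ m"
proof (induction m rule: cheb.induct)
  case 1
  have "(\<Sum>i\<le>k. \<bar>coeff 1 i\<bar>) \<le> (\<Sum>i\<le>k. if i = 0 then 1 else 0 :: real)"
    by (intro sum_mono) (auto simp: coeff_1)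
  then show ?case by simp
next
  case 2
  have "(\<Sum>i\<le>k. \<bar>coeff [:0, 1:] i\<bar>) \<le> (\<Sum>i\<le>k. if i = 1 then 1 else 0 :: real)"
    by (intro sum_mono) (auto simp: coeff_pCons split: nat.splits)
  also have "\<dots> \<le> 1" by simp
  finally show ?case by simp
next
  case (3 m)
  have shift: "(\<Sum>i\<le>k. \<bar>coeff (pCons 0 r) i\<bar>) \<le> (\<Sum>i\<le>k. \<bar>coeff r i\<bar>)" for r :: "real poly"
  proof (cases k)
    case (Suc k')
    then have "(\<Sum>i\<le>k. \<bar>coeff (pCons 0 r) i\<bar>) = (\<Sum>i\<le>k'. \<bar>coeff r i\<bar>)"
      by (simp add: sum.atMost_Suc_shift del: sum.atMost_Suc)
    then show ?thesis using Suc by simp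
  qed simp
  have "(\<Sum>i\<le>k. \<bar>coeff (cheb (Suc (Suc m))) i\<bar>)
      \<le> (\<Sum>i\<le>k. \<bar>coeff (pCons 0 (smult 2 (cheb (Suc m)))) i\<bar> + \<bar>coeff (cheb m) i\<bar>)"
    by (intro sum_mono) (simp add: abs_triangle_ineq4)
  also have "\<dots> \<le> (\<Sum>i\<le>k. \<bar>coeff (smult 2 (cheb (Suc m))) i\<bar>) + (\<Sum>i\<le>k. \<bar>coeff (cheb m) i\<bar>)"
    unfolding sum.distrib by (intro add_mono shift order_refl)
  also have "\<dots> = 2 * (\<Sum>i\<le>k. \<bar>coeff (cheb (Suc m)) i\<bar>) + (\<Sum>i\<le>k. \<bar>coeff (cheb m) i\<bar>)"
    by (simp add: abs_mult sum_distrib_left)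
  also have "\<dots> \<le> 2 * 3 ^ Suc m + 3 ^ m" using 3 by (intro add_mono mult_left_mono) auto
  also have "\<dots> \<le> 3 ^ Suc (Suc m)" by simp
  finally show ?case .
qed

lemma poly_cheb_altdef: "poly (cheb m) x = (\<Sum>k\<le>m. coeff (cheb m) k * x ^ k)"
  unfolding poly_altdef
  by (rule sum.mono_neutral_left) (use degree_cheb_le[of m] in \<open>auto intro: coeff_eq_0\<close>)

lemma poly_cheb_exp_square_le_one:
  assumes "0 \<le> l"
  shows "(poly (cheb m) (exp (- l)))\<^sup>2 \<le> 1"
proof -
  have "cos (arccos (exp (- l))) = exp (- l)" using assms by (intro cos_arccos) (auto intro: order_trans[of _ 0])
  then have "poly (cheb m) (exp (- l)) = cos (m * arccos (exp (- l)))"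
    using poly_cheb_cos[of m "arccos (exp (- l))"] by simp
  then show ?thesis by (simp add: abs_square_le_1)
qed

text \<open>
  At the scale \<open>\<lambda> \<approx> 1/m\<^sup>2\<close>, where \<open>x = e\<^sup>-\<^sup>\<lambda> = cos \<theta>\<close> has \<open>\<theta> \<approx> \<surd>(2\<lambda>)\<close>,
  the angle \<open>m \<theta>\<close> lies in \<open>[\<pi>/4, 3\<pi>/4]\<close>.
\<close>

lemma poly_cheb_exp_square_le_half:
  assumes m: "1 \<le> m" and l: "11 / 10 / (real m)\<^sup>2 \<le> l" "l \<le> 12 / 10 / (real m)\<^sup>2"
  shows "(poly (cheb m) (exp (- l)))\<^sup>2 \<le> 1 / 2"
proof -
  define t where "t = arccos (exp (- l))"
  have m2: "1 \<le> (real m)\<^sup>2" using m by (simp add: one_le_power)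
  have "0 < 11 / 10 / (real m)\<^sup>2" using m by simp
  then have l0: "0 < l" using l(1) by (rule less_le_trans)
  have "12 / 10 / (real m)\<^sup>2 \<le> 12 / 10 / 1" using m2 m by (intro divide_left_mono) auto
  then have l12: "l \<le> 12 / 10" using l(2) by linarith
  have cos_t: "cos t = exp (- l)"
    unfolding t_def using l0 by (intro cos_arccos) (auto intro: order_trans[of _ 0])
  have t0: "0 \<le> t" unfolding t_def using l0 by (intro arccos_lbound) (auto intro: order_trans[of _ 0])
  have t_pi: "t \<le> pi / 2" unfolding t_def using l0 by (intro arccos_le_pi2) auto
  \<comment> \<open>Estimates of sin (t/2) turn this identity into t^2/4 \<le> 1 - exp (- l) \<le>
    t^2/2.\<close>
  have sin_t: "1 - exp (- l) = 2 * (sin (t / 2))\<^sup>2"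
    using cos_double_sin[of "t / 2"] cos_t by simp
  have sin0: "0 \<le> sin (t / 2)" using t0 t_pi by (intro sin_ge_zero) auto
  have "sin (t / 2) \<le> t / 2" using t0 by (intro sin_x_le_x) auto
  then have "(sin (t / 2))\<^sup>2 \<le> (t / 2)\<^sup>2" using sin0 by (intro power_mono) auto
  then have up: "1 - exp (- l) \<le> t\<^sup>2 / 2" using sin_t by (simp add: power_divide)
  have "1 / 2 * (t / 2)\<^sup>2 \<le> (sin (t / 2))\<^sup>2"
  proof -
    \<comment> \<open>On [0, pi/4] one has x \<le> tan x and cos x \<ge> sqrt 2 / 2, so sin x \<ge>
      x sqrt 2 / 2.\<close>
    have half: "0 \<le> t / 2" "t / 2 \<le> pi / 4" "t / 2 < pi / 2" using t0 t_pi pi_gt_zero by linarith+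
    have "cos (pi / 4) \<le> cos (t / 2)" using half by (intro cos_monotone_0_pi_le) auto
    then have c: "sqrt 2 / 2 \<le> cos (t / 2)" by (simp add: cos_45)
    then have cpos: "0 < cos (t / 2)" by (rule less_le_trans[rotated]) simp
    have "t / 2 \<le> \<bar>tan (t / 2)\<bar>" using abs_tan_ge[of "t / 2"] half by simp
    then have "t / 2 \<le> sin (t / 2) / cos (t / 2)" using cpos sin0 by (simp add: tan_def)
    then have "t / 2 * cos (t / 2) \<le> sin (t / 2)" using cpos by (simp add: pos_le_divide_eq)
    then have "t / 2 * (sqrt 2 / 2) \<le> sin (t / 2)"
      using mult_left_mono[OF c half(1)] by linarith
    then have "(t / 2 * (sqrt 2 / 2))\<^sup>2 \<le> (sin (t / 2))\<^sup>2" using t0 by (intro power_mono) auto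
    then show ?thesis by (simp add: power_mult_distrib power_divide)
  qed
  then have low: "t\<^sup>2 / 4 \<le> 1 - exp (- l)" using sin_t by (simp add: power_divide)
  \<comment> \<open>From t^2 \<le> 4 l \<le> 4.8 / m^2 and 4.8 \<le> (9/4)^2; the number 9/4 is at
    most 3 pi / 4 because pi > 3.\<close>
  have "(m * t)\<^sup>2 \<le> (9 / 4)\<^sup>2"
  proof -
    have "1 - exp (- l) \<le> l" using exp_ge_add_one_self[of "- l"] by simp
    then have "t\<^sup>2 \<le> 48 / 10 / (real m)\<^sup>2" using low l(2) by simp
    then have "(real m)\<^sup>2 * t\<^sup>2 \<le> 48 / 10" using m by (simp add: field_simps)
    moreover have "48 / 10 \<le> (9 / 4 :: real)\<^sup>2" by (simp add: power2_eq_square)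
    ultimately show ?thesis unfolding power_mult_distrib[of "real m" t] by linarith
  qed
  then have "m * t \<le> 9 / 4" by (rule power2_le_imp_le) simp
  then have upper: "2 * (m * t) \<le> 3 * pi / 2" using pi_gt3 by simp
  \<comment> \<open>As l \<le> 1.2, t^2 / 2 \<ge> l / (1 + l) \<ge> l / 2.2 \<ge> 1 / (2 m^2); the
    number 1 is at least pi / 4 because pi < 4.\<close>
  have "1\<^sup>2 \<le> (m * t)\<^sup>2"
  proof -
    have "1 + l \<le> exp l" by (rule exp_ge_add_one_self)
    then have "exp (- l) \<le> 1 / (1 + l)" using l0 by (simp add: exp_minus field_simps)
    then have "1 - 1 / (1 + l) \<le> t\<^sup>2 / 2" using up by linarith
    moreover have "1 - 1 / (1 + l) = l / (1 + l)" using l0 by (simp add: field_simps)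
    moreover have "l / (22 / 10) \<le> l / (1 + l)" using l0 l12 by (intro divide_left_mono) auto
    ultimately have "1 / (real m)\<^sup>2 \<le> t\<^sup>2" using l(1) by simp
    then show ?thesis using m by (simp add: field_simps)
  qed
  then have "1 \<le> m * t" by (rule power2_le_imp_le) (use t0 in simp)
  then have lower: "pi / 2 \<le> 2 * (m * t)" using pi_less_4 by simp
  have "0 \<le> cos (2 * (m * t) - pi)" using lower upper by (intro cos_ge_zero) auto
  then have "cos (2 * (m * t)) \<le> 0" by (simp add: cos_diff)
  then have "2 * (cos (m * t))\<^sup>2 \<le> 1" by (simp add: cos_double_cos)
  then show ?thesis using poly_cheb_cos[of m t] cos_t by simp
qed

section \<open>The Bernstein representation of a power\<close>

text \<open>The integrand that represents u^q, up to a constant factor, as a mixture of the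
  functions 1 - exp (- u l), for 0 < q < 1.\<close>

definition frac_kernel :: "real \<Rightarrow> real \<Rightarrow> real \<Rightarrow> real" where
  "frac_kernel q u l = indicator {0<..} l * ((1 - exp (- (u * l))) * l powr (- 1 - q))"

lemma frac_kernel_measurable [measurable]: "frac_kernel q u \<in> borel_measurable borel"
  unfolding frac_kernel_def by measurable

text \<open>Near 0 the kernel is at most l^(-q), integrable as q < 1; near infinity it is at most
  l^(-1-q), integrable as q > 0.\<close>

lemma integrable_frac_kernel_one:
  assumes q: "0 < q" "q < 1"
  shows "integrable lborel (frac_kernel q 1)"
proof (rule Bochner_Integration.integrable_bound)
  have "(\<lambda>l. l powr (- q)) absolutely_integrable_on {0<..1}"
    using q by (intro nonnegative_absolutely_integrable_1 integrable_on_powr_from_0') auto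
  then have "integrable lborel (\<lambda>l. indicator {0<..1} l * l powr (- q) :: real)"
    unfolding set_integrable_def by (subst (asm) integrable_completion) auto
  moreover have "(\<lambda>l. l powr (- 1 - q)) absolutely_integrable_on {1..}"
    using q has_integral_powr_to_inf[of "- 1 - q" 1]
    by (intro nonnegative_absolutely_integrable_1) (auto simp: integrable_on_def)
  then have "integrable lborel (\<lambda>l. indicator {1..} l * l powr (- 1 - q) :: real)"
    unfolding set_integrable_def by (subst (asm) integrable_completion) auto
  ultimately show "integrable lborel (\<lambda>l. indicator {0<..1} l * l powr (- q) + indicator {1..} l * l powr (- 1 - q) :: real)"
    by (rule Bochner_Integration.integrable_add)
  show "AE l in lborel. norm (frac_kernel q 1 l)
      \<le> norm (indicator {0<..1} l * l powr (- q) + indicator {1..} l * l powr (- 1 - q) :: real)"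
  proof (rule AE_I2)
    fix l :: real
    show "norm (frac_kernel q 1 l)
      \<le> norm (indicator {0<..1} l * l powr (- q) + indicator {1..} l * l powr (- 1 - q) :: real)"
    proof (cases "0 < l")
      case True
      have "1 - exp (- l) \<le> l" using exp_ge_add_one_self[of "- l"] by simp
      then have "(1 - exp (- l)) * l powr (- 1 - q) \<le> l powr 1 * l powr (- 1 - q)"
        using True by (intro mult_right_mono) auto
      also have "\<dots> = l powr (- q)" by (subst powr_add[symmetric]) simp
      finally have "(1 - exp (- l)) * l powr (- 1 - q) \<le> l powr (- q)" .
      moreover have "(1 - exp (- l)) * l powr (- 1 - q) \<le> 1 * l powr (- 1 - q)"
        by (intro mult_right_mono) auto
      moreover have "0 \<le> (1 - exp (- l)) * l powr (- 1 - q)" using True by simp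
      ultimately show ?thesis using True by (auto simp: frac_kernel_def indicator_def intro: order_trans[of "- 1" 0])
    qed (simp add: frac_kernel_def)
  qed
qed simp

text \<open>The summand 0 gives the argument the shape required by the affine change of
  variables.\<close>

lemma frac_kernel_scale: "0 < u \<Longrightarrow> frac_kernel q u = (\<lambda>l. u powr (1 + q) * frac_kernel q 1 (0 + u * l))"
  by (auto simp: fun_eq_iff frac_kernel_def indicator_def powr_mult zero_less_mult_iff simp flip: powr_add)

lemma frac_kernel_zero [simp]: "frac_kernel q 0 = (\<lambda>_. 0)"
  by (simp add: fun_eq_iff frac_kernel_def)

lemma integrable_frac_kernel:
  assumes q: "0 < q" "q < 1" and u: "0 \<le> u"
  shows "integrable lborel (frac_kernel q u)"
proof (cases "u = 0")
  case False
  then have "integrable lborel (\<lambda>l. u powr (1 + q) * frac_kernel q 1 (0 + u * l))"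
    using integrable_frac_kernel_one[OF q] by (intro integrable_mult_right lborel_integrable_real_affine)
  then show ?thesis using False u by (subst frac_kernel_scale) auto
qed simp

lemma integral_frac_kernel:
  assumes u: "0 \<le> u"
  shows "(\<integral>l. frac_kernel q u l \<partial>lborel) = u powr q * (\<integral>l. frac_kernel q 1 l \<partial>lborel)"
proof (cases "u = 0")
  case False
  then have u: "0 < u" using u by simp
  have "(\<integral>l. frac_kernel q 1 l \<partial>lborel) = \<bar>u\<bar> *\<^sub>R (\<integral>l. frac_kernel q 1 (0 + u * l) \<partial>lborel)"
    using u by (intro lborel_integral_real_affine) auto
  moreover have "(\<integral>l. frac_kernel q u l \<partial>lborel) = u powr (1 + q) * (\<integral>l. frac_kernel q 1 (0 + u * l) \<partial>lborel)"
    using u by (subst frac_kernel_scale) auto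
  ultimately show ?thesis using u by (simp add: powr_add)
qed simp

text \<open>Times the constant \<open>I\<close>, the quadratic form is the integral of the
  nonnegative function (1 - P(exp(-x))^2) x^(-1-q). Near 1/m^2 this is of order m^(2+2q), on an
  interval of length of order 1/m^2.\<close>

lemma cheb_energy_ge:
  assumes q: "0 < q" "q < 1"
  obtains c where "0 < c" "\<And>m. 1 \<le> m \<Longrightarrow>
    c * real m powr (2 * q) \<le> (\<Sum>k\<le>m. \<Sum>l\<le>m. coeff (cheb m) k * coeff (cheb m) l * real (k + l) powr q)"
proof -
  define I where "I = (\<integral>l. frac_kernel q 1 l \<partial>lborel)"
  have ge: "real m powr (2 * q) / 32
      \<le> (\<Sum>k\<le>m. \<Sum>l\<le>m. coeff (cheb m) k * coeff (cheb m) l * real (k + l) powr q) * I"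
    if m: "1 \<le> m" for m
  proof -
    let ?c = "coeff (cheb m)" and ?a = "11 / 10 / (real m)\<^sup>2" and ?b = "12 / 10 / (real m)\<^sup>2"
    let ?g = "\<lambda>x. indicator {0<..} x * ((1 - (poly (cheb m) (exp (- x)))\<^sup>2) * x powr (- 1 - q))"
    have m0: "0 < real m" using m by simp
    have g: "(\<Sum>k\<le>m. \<Sum>l\<le>m. ?c k * ?c l * frac_kernel q (real (k + l)) x) = ?g x" for x
    proof -
      \<comment> \<open>P(1)^2 = 1 makes the constant terms of the kernels add up to exactly
        1.\<close>
      have one: "(\<Sum>k\<le>m. \<Sum>l\<le>m. ?c k * ?c l) = 1"
        using poly_cheb_one[of m] by (simp add: poly_cheb_altdef flip: sum_product)
      have "(\<Sum>k\<le>m. \<Sum>l\<le>m. ?c k * ?c l * exp (- (real (k + l) * x)))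
          = (\<Sum>k\<le>m. \<Sum>l\<le>m. (?c k * exp (- x) ^ k) * (?c l * exp (- x) ^ l))"
        by (intro sum.cong refl) (simp add: algebra_simps flip: exp_of_nat_mult exp_add)
      also have "\<dots> = (poly (cheb m) (exp (- x)))\<^sup>2"
        by (simp add: poly_cheb_altdef power2_eq_square sum_product)
      finally have two: "(\<Sum>k\<le>m. \<Sum>l\<le>m. ?c k * ?c l * exp (- (real (k + l) * x))) = (poly (cheb m) (exp (- x)))\<^sup>2" .
      have "(\<Sum>k\<le>m. \<Sum>l\<le>m. ?c k * ?c l * frac_kernel q (real (k + l)) x)
          = (\<Sum>k\<le>m. \<Sum>l\<le>m. (?c k * ?c l - ?c k * ?c l * exp (- (real (k + l) * x))) *
              (indicator {0<..} x * x powr (- 1 - q)))"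
        by (intro sum.cong refl) (simp add: frac_kernel_def algebra_simps)
      also have "\<dots> = (\<Sum>k\<le>m. \<Sum>l\<le>m. ?c k * ?c l - ?c k * ?c l * exp (- (real (k + l) * x))) *
              (indicator {0<..} x * x powr (- 1 - q))"
        by (simp only: sum_distrib_right)
      also have "\<dots> = ?g x" unfolding sum_subtractf one two by (simp add: mult_ac)
      finally show ?thesis .
    qed
    have int: "integrable lborel (\<lambda>x. \<Sum>k\<le>m. \<Sum>l\<le>m. ?c k * ?c l * frac_kernel q (real (k + l)) x)"
      using q by (intro Bochner_Integration.integrable_sum integrable_mult_right integrable_frac_kernel) auto
    have "(\<Sum>k\<le>m. \<Sum>l\<le>m. ?c k * ?c l * real (k + l) powr q) * I
        = (\<integral>x. (\<Sum>k\<le>m. \<Sum>l\<le>m. ?c k * ?c l * frac_kernel q (real (k + l)) x) \<partial>lborel)"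
      using q by (simp add: Bochner_Integration.integral_sum integrable_frac_kernel integral_frac_kernel
          sum_distrib_right mult.assoc flip: I_def del: of_nat_add)
    also have "\<dots> = integral\<^sup>L lborel ?g" unfolding g ..
    \<comment> \<open>Only the window where P^2 \<le> 1/2 is kept; outside it P^2 \<le> 1 makes the
      integrand nonnegative.\<close>
    also have "\<dots> \<ge> (\<integral>x. (?b powr (- 1 - q) / 2) * indicator {?a..?b} x \<partial>lborel)"
    proof (rule integral_mono)
      show "integrable lborel ?g" using int unfolding g .
      show "integrable lborel (\<lambda>x. (?b powr (- 1 - q) / 2) * indicator {?a..?b} x)"
        by (intro integrable_mult_right integrable_real_indicator) (auto simp: emeasure_lborel_Icc_eq)
      fix x
      show "?b powr (- 1 - q) / 2 * indicator {?a..?b} x \<le> ?g x"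
      proof (cases "x \<in> {?a..?b}")
        case True
        have "0 < ?a" using m0 by simp
        then have x: "0 < x" by (rule less_le_trans) (use True in auto)
        have "1 / 2 \<le> 1 - (poly (cheb m) (exp (- x)))\<^sup>2"
          using poly_cheb_exp_square_le_half[of m x] m True by simp
        moreover have "?b powr (- 1 - q) \<le> x powr (- 1 - q)"
          using True x q by (intro powr_mono2') auto
        ultimately have "1 / 2 * ?b powr (- 1 - q) \<le> (1 - (poly (cheb m) (exp (- x)))\<^sup>2) * x powr (- 1 - q)"
          by (intro mult_mono) auto
        then show ?thesis using True x by simp
      next
        case False
        then show ?thesis
          using poly_cheb_exp_square_le_one[of x m] by (auto simp: indicator_def)
      qed
    qed
    also have "(\<integral>x. (?b powr (- 1 - q) / 2) * indicator {?a..?b} x \<partial>lborel) = ?b powr (- 1 - q) / 2 * (?b - ?a)"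
    proof -
      have "?a \<le> ?b" by (intro divide_right_mono) auto
      then show ?thesis by simp
    qed
    also have "?b - ?a = 1 / 10 / (real m)\<^sup>2" by (simp add: field_simps)
    finally have "?b powr (- 1 - q) / 2 * (1 / 10 / (real m)\<^sup>2)
      \<le> (\<Sum>k\<le>m. \<Sum>l\<le>m. ?c k * ?c l * real (k + l) powr q) * I" .
    \<comment> \<open>As 1.2^(1+q) \<le> 1.44, the factor of m^(2q) is at least 1 / (1.44 * 20),
      which exceeds 1/32.\<close>
    moreover have "real m powr (2 * q) / 32 \<le> ?b powr (- 1 - q) / 2 * (1 / 10 / (real m)\<^sup>2)"
    proof -
      have "(12 / 10 :: real) powr (1 + q) \<le> (12 / 10) powr 2" using q by (intro powr_mono) auto
      also have "\<dots> = 144 / 100" by (simp add: powr_numeral power2_eq_square)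
      finally have "100 / 144 \<le> inverse ((12 / 10 :: real) powr (1 + q))"
        using le_imp_inverse_le[of "(12 / 10 :: real) powr (1 + q)" "144 / 100"] by simp
      also have "\<dots> = (12 / 10) powr (- 1 - q)" by (simp flip: powr_minus)
      finally have A: "100 / 144 \<le> (12 / 10 :: real) powr (- 1 - q)" .
      have "((real m)\<^sup>2) powr (- 1 - q) = real m powr (2 * (- 1 - q))"
        using m0 by (simp add: powr_powr flip: powr_numeral)
      moreover have "real m powr (2 + 2 * q) = 1 / real m powr (2 * (- 1 - q))"
        unfolding powr_minus_divide[symmetric] by (simp add: algebra_simps)
      moreover have "?b powr (- 1 - q) = (12 / 10) powr (- 1 - q) / (real m)\<^sup>2 powr (- 1 - q)"
        by (rule powr_divide)
      ultimately have "?b powr (- 1 - q) = (12 / 10) powr (- 1 - q) * real m powr (2 + 2 * q)"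
        by simp
      also have "real m powr (2 + 2 * q) = (real m)\<^sup>2 * real m powr (2 * q)"
        using m0 by (simp add: powr_add powr_numeral)
      finally have "?b powr (- 1 - q) / 2 * (1 / 10 / (real m)\<^sup>2) = (12 / 10) powr (- 1 - q) * (real m powr (2 * q) / 20)"
        using m0 by simp
      moreover have "100 / 144 * (real m powr (2 * q) / 20) \<le> (12 / 10) powr (- 1 - q) * (real m powr (2 * q) / 20)"
        using A by (intro mult_right_mono) auto
      moreover have "real m powr (2 * q) / 32 \<le> 100 / 144 * (real m powr (2 * q) / 20)" by simp
      ultimately show ?thesis by linarith
    qed
    ultimately show ?thesis by linarith
  qed
  have "0 \<le> I" unfolding I_def by (intro integral_nonneg_AE AE_I2) (auto simp: frac_kernel_def indicator_def)
  \<comment> \<open>The bound itself excludes I = 0, its left side being positive for m = 1.\<close>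
  moreover have "I \<noteq> 0" using ge[of 1] by auto
  ultimately have I: "0 < I" by simp
  show thesis
  proof (rule that[of "1 / (32 * I)"])
    show "0 < 1 / (32 * I)" using I by simp
    show "1 / (32 * I) * real m powr (2 * q)
      \<le> (\<Sum>k\<le>m. \<Sum>l\<le>m. coeff (cheb m) k * coeff (cheb m) l * real (k + l) powr q)" if "1 \<le> m" for m
      using ge[OF that] I by (simp add: field_simps)
  qed
qed

section \<open>Linear combinations of a finite family\<close>

text \<open>The operator v from R^m to R^n that sends the i-th unit vector to
  \<open>x i\<close>.\<close>

definition comb :: "nat \<Rightarrow> (nat \<Rightarrow> nat \<Rightarrow> real) \<Rightarrow> (nat \<Rightarrow> real) \<Rightarrow> nat \<Rightarrow> real" where
  "comb m x y = (\<lambda>j. \<Sum>i<m. y i * x i j)"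

text \<open>The Euclidean inner product of R^n pulled back along v.\<close>

definition gram :: "nat \<Rightarrow> nat \<Rightarrow> (nat \<Rightarrow> nat \<Rightarrow> real) \<Rightarrow> (nat \<Rightarrow> real) \<Rightarrow> (nat \<Rightarrow> real) \<Rightarrow> real" where
  "gram n m x y z = (\<Sum>j<n. comb m x y j * comb m x z j)"

text \<open>The squared Hilbert-Schmidt norm of v.\<close>

definition hs_sq :: "nat \<Rightarrow> nat \<Rightarrow> (nat \<Rightarrow> nat \<Rightarrow> real) \<Rightarrow> real" where
  "hs_sq n m x = (\<Sum>i<m. (norm2 n (x i))\<^sup>2)"

lemma norm2_sq: "(norm2 n x)\<^sup>2 = (\<Sum>j<n. (x j)\<^sup>2)"
  by (simp add: norm2_def L2_set_def sum_nonneg)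

lemma hs_sq_nonneg [simp]: "0 \<le> hs_sq n m x"
  by (simp add: hs_sq_def sum_nonneg)

lemma comb_add: "comb m x (y + z) j = comb m x y j + comb m x z j"
  and comb_diff: "comb m x (y - z) j = comb m x y j - comb m x z j"
  and comb_scale: "comb m x (\<lambda>i. s * y i) j = s * comb m x y j"
  by (simp_all add: comb_def sum.distrib sum_subtractf sum_distrib_left algebra_simps)

lemma comb_unit_vec: "i < m \<Longrightarrow> comb m x (unit_vec i) = x i"
  by (auto simp: comb_def unit_vec_def if_distrib[of "\<lambda>t. t * _"] cong: if_cong)

lemma gram_self: "gram n m x y y = (norm2 n (comb m x y))\<^sup>2"
  unfolding gram_def norm2_sq by (simp add: power2_eq_square)

lemma gram_scale: "gram n m x (\<lambda>i. s * y i) (\<lambda>i. s * y i) = s\<^sup>2 * gram n m x y y"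
  by (simp add: gram_def comb_scale sum_distrib_left power2_eq_square mult_ac)

interpretation gram: pos_quadratic "gram n m x" for n m x
proof
  fix y z w
  show "gram n m x (y + z) w = gram n m x y w + gram n m x z w"
    by (simp add: gram_def comb_add sum.distrib distrib_right)
  show "gram n m x y z = gram n m x z y" by (simp add: gram_def mult.commute)
  show "0 \<le> gram n m x y y" by (simp add: gram_self)
  show "(gram n m x y z)\<^sup>2 \<le> gram n m x y y * gram n m x z z"
    unfolding gram_def power2_eq_square[of "comb _ _ _ _", symmetric]
    using Cauchy_Schwarz_ineq_sum[of "comb m x y" "comb m x z" "{..<n}"]
    by (simp add: power2_eq_square)
qed

lemma gram_le_hs_sq: "gram n m x y y \<le> hs_sq n m x * sqnorm m y"
proof -
  have "gram n m x y y = (\<Sum>j<n. (\<Sum>i<m. y i * x i j)\<^sup>2)"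
    by (simp add: gram_def comb_def power2_eq_square)
  also have "\<dots> \<le> (\<Sum>j<n. sqnorm m y * (\<Sum>i<m. (x i j)\<^sup>2))"
    unfolding sqnorm_def by (intro sum_mono Cauchy_Schwarz_ineq_sum)
  also have "\<dots> = hs_sq n m x * sqnorm m y"
    unfolding hs_sq_def norm2_sq by (subst sum.swap) (simp add: sum_distrib_left mult.commute)
  finally show ?thesis .
qed

lemma dist2_comb_powr:
  "dist2 n (comb m x y) (comb m x z) powr (2 * q) = gram n m x (y - z) (y - z) powr q"
proof -
  have "dist2 n (comb m x y) (comb m x z) = norm2 n (comb m x (y - z))"
  proof -
    have "comb m x (y - z) = (\<lambda>j. comb m x y j - comb m x z j)" by (simp add: fun_eq_iff comb_diff)
    then show ?thesis by (simp add: dist2_def)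
  qed
  moreover have "0 \<le> norm2 n (comb m x (y - z))" by (simp add: norm2_def)
  ultimately show ?thesis
    by (simp add: gram_self powr_powr flip: powr_numeral)
qed

lemma sum_list_rounds_gram: "(\<Sum>w\<leftarrow>rounds m K. gram n m x w w) = real K * hs_sq n m x"
  by (simp add: sum_list_rounds hs_sq_def gram_self comb_unit_vec)

definition walk_energy :: "nat \<Rightarrow> nat \<Rightarrow> (nat \<Rightarrow> nat \<Rightarrow> real) \<Rightarrow> real \<Rightarrow> nat \<Rightarrow> real" where
  "walk_energy n m x q K = rad (rounds m K) (\<lambda>y. gram n m x y y powr q)"

text \<open>By symmetry of the signs, the difference of independent sums with K and L rounds has the
  law of a sum with K + L rounds. Mutual energies thus depend on K + L only.\<close>

lemma rad_rounds_diff: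
  "rad (rounds m K) (\<lambda>y. rad (rounds m L) (\<lambda>z. f (y - z))) = rad (rounds m (K + L)) f"
proof -
  have "rad (rounds m L) (\<lambda>z. f (y - z)) = rad (rounds m L) (\<lambda>z. f (y + z))" for y
    using rad_uminus[of "rounds m L" "\<lambda>z. f (y + z)"] by simp
  then show ?thesis by (simp add: rounds_add rad_append)
qed

lemma ex_walk_energy_ge:
  assumes q: "0 < q" "q < 1" and hs: "0 < hs_sq n m x" and A: "0 < A"
    and cheb: "A \<le> (\<Sum>k\<le>m. \<Sum>l\<le>m. coeff (cheb m) k * coeff (cheb m) l * real (k + l) powr q)"
  obtains L where "1 \<le> L" "(real L * hs_sq n m x) powr q * A / 8
    \<le> (\<Sum>k\<le>m. \<Sum>l\<le>m. coeff (cheb m) k * coeff (cheb m) l * walk_energy n m x q ((k + l) * L))"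
proof -
  let ?c = "coeff (cheb m)" and ?h = "hs_sq n m x" and ?E = "walk_energy n m x q"
  \<comment> \<open>Pairs with the same k + l are collected, and the ideal growth j^q is put into
    the weight; \<open>G\<close> below is the remaining factor, which the moment bounds keep between
    \<open>?h powr q / 4\<close> and \<open>2 * ?h powr q\<close>.\<close>
  define w where "w j = (\<Sum>k\<le>m. \<Sum>l\<le>m. if k + l = j then ?c k * ?c l * real j powr q else 0)" for j
  define G where "G K = ?E K / real K powr q" for K
  have w_sum: "(\<Sum>j=1..2*m. w j * H j) = (\<Sum>k\<le>m. \<Sum>l\<le>m. ?c k * ?c l * (real (k + l) powr q * H (k + l)))" for H
  proof -
    have "(\<Sum>j=1..2*m. w j * H j)
        = (\<Sum>k\<le>m. \<Sum>l\<le>m. \<Sum>j=1..2*m. if k + l = j then ?c k * ?c l * (real j powr q * H j) else 0)"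
      unfolding w_def sum_distrib_right
      by (subst sum.swap, rule sum.cong[OF refl], subst sum.swap) (intro sum.cong refl; simp)
    also have "\<dots> = (\<Sum>k\<le>m. \<Sum>l\<le>m. ?c k * ?c l * (real (k + l) powr q * H (k + l)))"
      by (intro sum.cong refl) (auto simp: sum.delta')
    finally show ?thesis .
  qed
  have bounds: "?h powr q / 4 \<le> G K" "G K \<le> 2 * ?h powr q" if K: "1 \<le> K" for K
  proof -
    have pos: "0 < real K * ?h" using K hs by simp
    have "(real K * ?h) powr q / 4 \<le> ?E K" "?E K \<le> 2 * (real K * ?h) powr q"
      unfolding walk_energy_def
      using gram.rad_quadratic_powr_bounds[OF q sum_list_rounds_gram[symmetric] pos] by auto
    then show "?h powr q / 4 \<le> G K" "G K \<le> 2 * ?h powr q"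
      using K by (simp_all add: G_def powr_mult field_simps)
  qed
  have w_total: "(\<Sum>j=1..2*m. w j) = (\<Sum>k\<le>m. \<Sum>l\<le>m. ?c k * ?c l * real (k + l) powr q)"
    using w_sum[of "\<lambda>_. 1"] by simp
  have w_pos: "0 < (\<Sum>j=1..2*m. w j)" using w_total A cheb by simp
  have h_pos: "0 < ?h powr q / 4" using hs by simp
  obtain L where L: "1 \<le> L"
    "?h powr q / 4 * (\<Sum>j=1..2*m. w j) / 2 \<le> (\<Sum>j=1..2*m. w j * G (j * L))"
    using ex_dilation_sum_ge[where G=G and w=w and J="2 * m", OF bounds h_pos w_pos] by blast
  \<comment> \<open>The pair k = l = 0 contributes 0 on both sides, in accordance with the sums over
    j starting at 1.\<close>
  have "real (k + l) powr q * G ((k + l) * L) = ?E ((k + l) * L) / real L powr q" for k l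
  proof (cases "k + l = 0")
    case True
    then show ?thesis by (simp add: walk_energy_def)
  next
    case False
    then show ?thesis using L(1) False by (auto simp: G_def powr_mult simp del: of_nat_add)
  qed
  then have "?h powr q / 4 * (\<Sum>j=1..2*m. w j) / 2 \<le> (\<Sum>k\<le>m. \<Sum>l\<le>m. ?c k * ?c l * ?E ((k + l) * L)) / real L powr q"
    using L(2) unfolding w_sum[of "\<lambda>j. G (j * L)"] by (simp add: sum_divide_distrib)
  moreover have "?h powr q / 4 * A / 2 \<le> ?h powr q / 4 * (\<Sum>j=1..2*m. w j) / 2"
    using cheb w_total by (intro divide_right_mono mult_left_mono) auto
  ultimately have "?h powr q / 4 * A / 2 \<le> (\<Sum>k\<le>m. \<Sum>l\<le>m. ?c k * ?c l * ?E ((k + l) * L)) / real L powr q"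
    by linarith
  then have "(real L * ?h) powr q * A / 8 \<le> (\<Sum>k\<le>m. \<Sum>l\<le>m. ?c k * ?c l * ?E ((k + l) * L))"
    using L(1) by (simp add: powr_mult field_simps)
  with L(1) show thesis by (rule that)
qed

section \<open>Truncation\<close>

text \<open>The scaled vector, with values outside the Euclidean unit ball moved to the
  origin.\<close>

definition truncated :: "nat \<Rightarrow> real \<Rightarrow> (nat \<Rightarrow> real) \<Rightarrow> nat \<Rightarrow> real" where
  "truncated m s y = (if s\<^sup>2 * sqnorm m y \<le> 1 then (\<lambda>i. s * y i) else 0)"

lemma sqnorm_scale: "sqnorm m (\<lambda>i. s * y i) = s\<^sup>2 * sqnorm m y"
  by (simp add: sqnorm_def sum_distrib_left power_mult_distrib)

lemma sqnorm_zero [simp]: "sqnorm m 0 = 0"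
  by (simp add: sqnorm_def)

lemma sqnorm_truncated: "sqnorm m (truncated m s y) \<le> 1" "sqnorm m (truncated m s y) \<le> s\<^sup>2 * sqnorm m y"
  by (auto simp: truncated_def sqnorm_scale)

lemma sqnorm_diff_le: "sqnorm m (y - z) \<le> 2 * (sqnorm m y + sqnorm m z)"
proof -
  have "(a - b)\<^sup>2 \<le> 2 * (a\<^sup>2 + b\<^sup>2)" for a b :: real
    using zero_le_power2[of "a + b"] by (simp add: power2_eq_square algebra_simps)
  then show ?thesis
    by (simp add: sqnorm_def sum_distrib_left flip: sum.distrib) (rule sum_mono, simp)
qed

text \<open>An error occurs only if the scaled squared lengths add up to some t \<ge> 1. Both terms
  are then at most a multiple of (2 t)^q \<le> 2 exp (a (t - 1)), a bound that splits into a factor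
  in y and a factor in z.\<close>

lemma truncation_error:
  assumes q: "0 < q" "q < 1" and a: "1 \<le> a"
  shows "\<bar>gram n m x (truncated m s y - truncated m s z) (truncated m s y - truncated m s z) powr q
      - (s\<^sup>2 * gram n m x (y - z) (y - z)) powr q\<bar>
    \<le> 2 * hs_sq n m x powr q * exp (- a) * exp (a * s\<^sup>2 * sqnorm m y) * exp (a * s\<^sup>2 * sqnorm m z)"
    (is "\<bar>?V - ?U\<bar> \<le> ?R")
proof -
  let ?t = "s\<^sup>2 * sqnorm m y + s\<^sup>2 * sqnorm m z"
  have eq: "(\<lambda>i. s * y i) - (\<lambda>i. s * z i) = (\<lambda>i. s * (y - z) i)"
    by (auto simp: algebra_simps)
  have U: "?U = gram n m x ((\<lambda>i. s * y i) - (\<lambda>i. s * z i)) ((\<lambda>i. s * y i) - (\<lambda>i. s * z i)) powr q"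
    unfolding eq by (simp only: gram_scale)
  have R: "?R = hs_sq n m x powr q * (2 * exp (a * (?t - 1)))"
    by (simp add: algebra_simps flip: exp_add)
  show ?thesis
  proof (cases "s\<^sup>2 * sqnorm m y \<le> 1 \<and> s\<^sup>2 * sqnorm m z \<le> 1")
    case True
    then have "?V = ?U" unfolding U by (simp add: truncated_def)
    then show ?thesis by simp
  next
    case False
    moreover have "0 \<le> s\<^sup>2 * sqnorm m y" "0 \<le> s\<^sup>2 * sqnorm m z" by auto
    ultimately have t: "1 \<le> ?t" by linarith
    \<comment> \<open>Used twice: for the truncated pair and for the merely scaled pair.\<close>
    have le: "gram n m x (u - v) (u - v) powr q \<le> ?R"
      if "sqnorm m u \<le> s\<^sup>2 * sqnorm m y" "sqnorm m v \<le> s\<^sup>2 * sqnorm m z" for u v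
    proof -
      have "gram n m x (u - v) (u - v) \<le> hs_sq n m x * sqnorm m (u - v)" by (rule gram_le_hs_sq)
      also have "\<dots> \<le> hs_sq n m x * (2 * ?t)"
        using sqnorm_diff_le[of m u v] that by (intro mult_left_mono) auto
      finally have "gram n m x (u - v) (u - v) powr q \<le> (hs_sq n m x * (2 * ?t)) powr q"
        using q gram.pos by (intro powr_mono2) auto
      also have "\<dots> = hs_sq n m x powr q * (2 * ?t) powr q"
        by (rule powr_mult)
      also have "\<dots> \<le> hs_sq n m x powr q * (2 * exp (a * (?t - 1)))"
      proof (intro mult_left_mono)
        have "(2 * ?t) powr q \<le> (2 * ?t) powr 1" using t q by (intro powr_mono) auto
        also have "\<dots> = 2 * (1 + (?t - 1))" using t by simp
        also have "\<dots> \<le> 2 * exp (?t - 1)" using exp_ge_add_one_self[of "?t - 1"] by simp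
        also have "\<dots> \<le> 2 * exp (a * (?t - 1))" using mult_right_mono[OF a, of "?t - 1"] t by simp
        finally show "(2 * ?t) powr q \<le> 2 * exp (a * (?t - 1))" .
      qed simp
      finally show ?thesis unfolding R .
    qed
    have "?V \<le> ?R" by (rule le) (rule sqnorm_truncated)+
    moreover have "?U \<le> ?R" unfolding U by (rule le) (simp_all add: sqnorm_scale)
    moreover have "0 \<le> ?V" "0 \<le> ?U" by auto
    ultimately show ?thesis by linarith
  qed
qed

text \<open>For K \<le> m L the scaled sum has mean squared length at most 1/(8 D), so leaving the
  unit ball is exponentially unlikely in m, at a rate set by D.\<close>

lemma rad_truncated_energy:
  assumes q: "0 < q" "q < 1" and D: "1 \<le> D" and m: "1 \<le> m" and L: "1 \<le> L"
    and K: "K \<le> m * L" "K' \<le> m * L" and s: "s\<^sup>2 = 1 / (8 * D * (real m)\<^sup>2 * real L)"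
  shows "\<bar>rad (rounds m K) (\<lambda>y. rad (rounds m K') (\<lambda>z.
        gram n m x (truncated m s y - truncated m s z) (truncated m s y - truncated m s z) powr q))
      - (s\<^sup>2) powr q * walk_energy n m x q (K + K')\<bar> \<le> 2 * hs_sq n m x powr q * exp (m - D * m)"
proof -
  let ?V = "\<lambda>y z. gram n m x (truncated m s y - truncated m s z) (truncated m s y - truncated m s z) powr q"
  let ?U = "\<lambda>y z. (s\<^sup>2 * gram n m x (y - z) (y - z)) powr q"
  \<comment> \<open>Then a s^2 = 1/(8 m L), the largest rate that \<open>rad_rounds_exp_le\<close>
    admits for m L rounds. Each exponential moment is at most exp (m/2), against the gain exp (- D
    m).\<close>
  define a where "a = D * m"
  have "1 * 1 \<le> D * real m" using D m by (intro mult_mono) auto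
  then have a: "1 \<le> a" by (simp add: a_def)
  have b: "a * s\<^sup>2 = 1 / (8 * real m * real L)"
    unfolding a_def s using D m L by (simp add: field_simps power2_eq_square)
  have exp_le: "rad (rounds m J) (\<lambda>y. exp (a * s\<^sup>2 * sqnorm m y)) \<le> exp (m / 2)" if J: "J \<le> m * L" for J
  proof -
    have J': "real J \<le> real m * real L" using J by (simp flip: of_nat_mult)
    have pos: "0 < real m * real L" using m L by simp
    have "rad (rounds m J) (\<lambda>y. exp (a * s\<^sup>2 * sqnorm m y)) \<le> exp (2 * (a * s\<^sup>2) * real J * m)"
    proof (rule rad_rounds_exp_le)
      show "0 < a * s\<^sup>2" unfolding b using m L by simp
      show "8 * (a * s\<^sup>2) * real J \<le> 1" unfolding b using J' pos by (simp add: field_simps)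
    qed
    also have "2 * (a * s\<^sup>2) * real J * m \<le> m / 2"
    proof -
      have "real J / (real m * real L) \<le> 1" using J' pos by simp
      then have "real J / (real m * real L) * (m / 4) \<le> 1 * (m / 4)" by (rule mult_right_mono) simp
      then show ?thesis unfolding b by (simp add: mult_ac)
    qed
    finally show ?thesis by simp
  qed
  have "(s\<^sup>2) powr q * walk_energy n m x q (K + K') = rad (rounds m K) (\<lambda>y. rad (rounds m K') (?U y))"
    by (simp add: walk_energy_def powr_mult gram.pos rad_cmult rad_rounds_diff[of m K K' "\<lambda>y. gram n m x y y powr q"])
  then have diff: "rad (rounds m K) (\<lambda>y. rad (rounds m K') (?V y)) - (s\<^sup>2) powr q * walk_energy n m x q (K + K')
      = rad (rounds m K) (\<lambda>y. rad (rounds m K') (\<lambda>z. ?V y z - ?U y z))"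
    by (simp add: rad_diff)
  have "\<bar>rad (rounds m K) (\<lambda>y. rad (rounds m K') (\<lambda>z. ?V y z - ?U y z))\<bar>
      \<le> rad (rounds m K) (\<lambda>y. rad (rounds m K') (\<lambda>z. \<bar>?V y z - ?U y z\<bar>))"
    by (rule order_trans[OF abs_rad_le rad_mono]) (rule abs_rad_le)
  also have "\<dots> \<le> rad (rounds m K) (\<lambda>y. rad (rounds m K') (\<lambda>z.
      2 * hs_sq n m x powr q * exp (- a) * exp (a * s\<^sup>2 * sqnorm m y) * exp (a * s\<^sup>2 * sqnorm m z)))"
    by (intro rad_mono truncation_error q a)
  also have "\<dots> = 2 * hs_sq n m x powr q * exp (- a) * rad (rounds m K) (\<lambda>y. exp (a * s\<^sup>2 * sqnorm m y))
      * rad (rounds m K') (\<lambda>z. exp (a * s\<^sup>2 * sqnorm m z))"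
    by (simp only: rad_cmult rad_cmult_right)
  also have "\<dots> \<le> 2 * hs_sq n m x powr q * exp (- a) * exp (m / 2) * exp (m / 2)"
    by (intro mult_mono mult_nonneg_nonneg exp_le K rad_nonneg order_refl) auto
  also have "\<dots> = 2 * hs_sq n m x powr q * exp (m - D * m)"
    by (simp add: a_def mult.assoc flip: exp_add)
  finally show ?thesis unfolding diff .
qed


section \<open>The signed measure\<close>

text \<open>The signed combination of the laws of g at the random sums of \<open>ws k\<close>, with
  coefficients c k for k \<le> m, as a list of weighted points.\<close>

definition mixture ::
    "(nat \<Rightarrow> real) \<Rightarrow> (nat \<Rightarrow> 'a::ab_group_add list) \<Rightarrow> ('a \<Rightarrow> 'b) \<Rightarrow> nat \<Rightarrow> (real \<times> 'b) list" where
  "mixture c ws g m =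
     concat (map (\<lambda>k. map (\<lambda>y. (c k / 2 ^ length (ws k), g y)) (sign_sums (ws k))) [0..<Suc m])"

lemma sum_list_mixture:
  "(\<Sum>(a, z)\<leftarrow>mixture c ws g m. a * f z) = (\<Sum>k\<le>m. c k * rad (ws k) (\<lambda>y. f (g y)))"
proof -
  have block: "(\<Sum>(a, z)\<leftarrow>map (\<lambda>y. (c k / 2 ^ length (ws k), g y)) (sign_sums (ws k)). a * f z)
      = c k * rad (ws k) (\<lambda>y. f (g y))" for k
    using sum_list_const_mult[of "c k / 2 ^ length (ws k)" "\<lambda>y. f (g y)" "sign_sums (ws k)"]
    by (simp add: rad_def o_def)
  have "(\<Sum>(a, z)\<leftarrow>concat (map (\<lambda>k. map (\<lambda>y. (c k / 2 ^ length (ws k), g y)) (sign_sums (ws k))) ks). a * f z)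
      = (\<Sum>k\<leftarrow>ks. c k * rad (ws k) (\<lambda>y. f (g y)))" for ks
    by (induction ks) (auto simp: block simp del: map_map)
  then show ?thesis
    unfolding mixture_def by (simp only: interv_sum_list_conv_sum_set_nat set_upt atLeast0LessThan lessThan_Suc_atMost)
qed

lemma set_mixture: "snd ` set (mixture c ws g m) \<subseteq> range g"
  by (auto simp: mixture_def)

lemma dist2_measurable [measurable]:
  "(\<lambda>x. dist2 n x y) \<in> borel_measurable borel" "dist2 n x \<in> borel_measurable borel"
proof -
  have [measurable]: "(\<lambda>x::nat \<Rightarrow> real. x i) \<in> borel_measurable borel" for i
    by (rule measurable_product_coordinates)
  show "(\<lambda>x. dist2 n x y) \<in> borel_measurable borel" "dist2 n x \<in> borel_measurable borel"
    unfolding dist2_def norm2_def L2_set_def by measurable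
qed

text \<open>The point mass at the origin has energy 0.\<close>

lemma max_energy_unit_ball_nonneg:
  assumes "is_norm n N"
  shows "0 \<le> max_energy p (unit_ball n N) (dist2 n)"
proof -
  have "(\<lambda>_. 0) \<in> unit_ball n N" 
  proof -
    have "N (\<lambda>_. 0) = 0" using assms Rn_closed(4)[of n] unfolding is_norm_def by blast
    then show ?thesis by (simp add: unit_ball_def)
  qed
  then show ?thesis
    using energy_list_le_max_energy[of "[(1, \<lambda>_. 0)]" "unit_ball n N" "dist2 n" p]
    by (simp add: dist2_def norm2_def L2_set_def zero_ereal_def)
qed

text \<open>The competitor is the Chebyshev combination of the laws of the truncated sums with k L
  rounds, mapped by v into the unit ball. The main term carries the factor 1/8, and truncation
  consumes at most half of it.\<close>

lemma max_energy_ge_hs_sq: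
  assumes q: "0 < q" "q < 1" and A: "0 < A"
    and cheb: "\<And>m. 1 \<le> m \<Longrightarrow>
      A * real m powr (2 * q) \<le> (\<Sum>k\<le>m. \<Sum>l\<le>m. coeff (cheb m) k * coeff (cheb m) l * real (k + l) powr q)"
    and D: "5 \<le> D" "512 * exp 5 \<le> A * D"
    and N: "is_norm n N" and x: "\<And>i. i < m \<Longrightarrow> x i \<in> Rn n"
    and ball: "\<And>y. N (comb m x y) \<le> sqrt (sqnorm m y)"
  shows "ereal ((1 / (8 * D)) powr q * A / 16 * hs_sq n m x powr q) \<le> max_energy (2 * q) (unit_ball n N) (dist2 n)"
proof (cases "hs_sq n m x = 0")
  case True
  then show ?thesis using max_energy_unit_ball_nonneg[OF N] by (simp add: zero_ereal_def)
next
  case False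
  let ?c = "coeff (cheb m)" and ?h = "hs_sq n m x" and ?E = "walk_energy n m x q"
  have h: "0 < ?h" using False by (simp add: less_le)
  have m: "1 \<le> m" using False by (cases m) (auto simp: hs_sq_def)
  have "0 < A * real m powr (2 * q)" using A m by simp
  then obtain L where L: "1 \<le> L" and
    main: "(real L * ?h) powr q * (A * real m powr (2 * q)) / 8
      \<le> (\<Sum>k\<le>m. \<Sum>l\<le>m. ?c k * ?c l * ?E ((k + l) * L))"
    using ex_walk_energy_ge[OF q h _ cheb[OF m]] by blast
  define s where "s = sqrt (1 / (8 * D * (real m)\<^sup>2 * real L))"
  have s: "s\<^sup>2 = 1 / (8 * D * (real m)\<^sup>2 * real L)" using D by (simp add: s_def)
  define ws where "ws k = rounds m (k * L)" for k
  define g where "g y = comb m x (truncated m s y)" for y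
  define V where "V k l = rad (ws k) (\<lambda>y. rad (ws l) (\<lambda>z.
      gram n m x (truncated m s y - truncated m s z) (truncated m s y - truncated m s z) powr q))" for k l
  let ?l = "mixture ?c ws g m"
  have "range g \<subseteq> unit_ball n N"
  proof safe
    fix y
    have "linear_functional n (\<lambda>_. 0)" by (simp add: linear_functional_def)
    then have "g y \<in> Rn n" unfolding g_def comb_def using x by (rule linear_functional_sum(1))
    moreover have "N (g y) \<le> sqrt (sqnorm m (truncated m s y))" unfolding g_def by (rule ball)
    then have "N (g y) \<le> 1" using sqnorm_truncated(1)[of m s y] by (meson order_trans real_sqrt_le_1_iff)
    ultimately show "g y \<in> unit_ball n N" by (simp add: unit_ball_def)
  qed
  then have sub: "snd ` set ?l \<subseteq> unit_ball n N" using set_mixture by (rule subset_trans[rotated])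
  have one: "(\<Sum>(c, z)\<leftarrow>?l. c) = 1"
    using sum_list_mixture[of "\<lambda>_. 1" ?c ws g m] poly_cheb_one[of m] by (simp add: poly_cheb_altdef)
  have "(\<Sum>(c, y)\<leftarrow>?l. c * (\<Sum>(c', z)\<leftarrow>?l. c' * dist2 n z y powr (2 * q)))
      = (\<Sum>k\<le>m. ?c k * rad (ws k) (\<lambda>y. \<Sum>l\<le>m. ?c l * rad (ws l) (\<lambda>z. dist2 n (g z) (g y) powr (2 * q))))"
    unfolding sum_list_mixture ..
  also have "\<dots> = (\<Sum>k\<le>m. \<Sum>l\<le>m. ?c k * ?c l * V k l)"
  proof -
    have "dist2 n (g z) (g y) powr (2 * q) = gram n m x (truncated m s y - truncated m s z) (truncated m s y - truncated m s z) powr q"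
      for y z
      unfolding g_def dist2_comb_powr[symmetric] by (simp add: dist2_def norm2_def L2_set_def power2_commute)
    then show ?thesis by (simp add: V_def rad_sum rad_cmult sum_distrib_left mult.assoc)
  qed
  finally have energy: "ereal (\<Sum>k\<le>m. \<Sum>l\<le>m. ?c k * ?c l * V k l) \<le> max_energy (2 * q) (unit_ball n N) (dist2 n)"
    using energy_list_le_max_energy[where d="dist2 n" and p="2 * q", OF sub one dist2_measurable] by simp
  let ?R = "2 * ?h powr q * exp (m - D * m)"
  have "(\<Sum>k\<le>m. \<Sum>l\<le>m. ?c k * ?c l * ((s\<^sup>2) powr q * ?E ((k + l) * L))) - (\<Sum>k\<le>m. \<Sum>l\<le>m. ?c k * ?c l * V k l)
      \<le> (\<Sum>k\<le>m. \<Sum>l\<le>m. \<bar>?c k\<bar> * \<bar>?c l\<bar> * ?R)"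
    unfolding sum_subtractf[symmetric]
  proof (intro sum_mono)
    fix k l assume kl: "k \<in> {..m}" "l \<in> {..m}"
    have "\<bar>V k l - (s\<^sup>2) powr q * ?E (k * L + l * L)\<bar> \<le> ?R"
      unfolding V_def ws_def using kl D by (intro rad_truncated_energy[OF q _ m L _ _ s]) auto
    then have "\<bar>?c k * ?c l\<bar> * \<bar>(s\<^sup>2) powr q * ?E ((k + l) * L) - V k l\<bar> \<le> \<bar>?c k * ?c l\<bar> * ?R"
      by (intro mult_left_mono) (auto simp: abs_minus_commute add_mult_distrib)
    then have "\<bar>?c k * ?c l * ((s\<^sup>2) powr q * ?E ((k + l) * L) - V k l)\<bar> \<le> \<bar>?c k\<bar> * \<bar>?c l\<bar> * ?R"
      by (simp add: abs_mult)
    then show "?c k * ?c l * ((s\<^sup>2) powr q * ?E ((k + l) * L)) - ?c k * ?c l * V k l \<le> \<bar>?c k\<bar> * \<bar>?c l\<bar> * ?R"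
      by (simp add: right_diff_distrib)
  qed
  also have "\<dots> = (\<Sum>k\<le>m. \<bar>?c k\<bar>) * (\<Sum>l\<le>m. \<bar>?c l\<bar>) * ?R"
    unfolding sum_product by (simp only: sum_distrib_right)
  also have "\<dots> \<le> 3 ^ m * 3 ^ m * ?R"
    by (intro mult_right_mono mult_mono sum_abs_coeff_cheb_le) (auto intro: sum_nonneg)
  also have "\<dots> \<le> (1 / (8 * D)) powr q * A / 16 * ?h powr q"
  proof -
    \<comment> \<open>With 9 \<le> exp 4, the squared total variation times the truncation error is
      at most of order exp (5 - D), hence of order 1/D^2. The main term decays only like D^(-q), so
      a large D wins.\<close>
    have "(2::real) ^ 4 \<le> exp 1 ^ 4" using exp_ge_add_one_self[of 1] by (intro power_mono) auto
    then have "9 \<le> exp (4 :: real)" by (simp flip: exp_of_nat_mult)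
    then have "9 ^ m \<le> exp (4 :: real) ^ m" by (intro power_mono) auto
    then have "9 ^ m * exp (m - D * m) \<le> exp (real m * 4) * exp (m - D * m)"
      by (simp flip: exp_of_nat_mult)
    also have "\<dots> = exp (real m * (5 - D))" by (simp add: algebra_simps flip: exp_add)
    also have "\<dots> \<le> exp (1 * (5 - D))"
      using D m by (intro iffD2[OF exp_le_cancel_iff] mult_right_mono_neg) auto
    also have "\<dots> = exp 5 / exp D" by (simp add: exp_diff)
    also have "\<dots> \<le> exp 5 / (D\<^sup>2 / 2)"
      using D exp_lower_Taylor_quadratic[of D] by (intro divide_left_mono) auto
    finally have "2 * (9 ^ m * exp (m - D * m)) \<le> 4 * exp 5 / D\<^sup>2" by simp
    also have "\<dots> \<le> A / (128 * D)" using D by (simp add: power2_eq_square field_simps)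
    also have "\<dots> = (1 / (8 * D)) powr 1 * A / 16" using D by simp
    also have "\<dots> \<le> (1 / (8 * D)) powr q * A / 16"
      using D q A by (intro divide_right_mono mult_right_mono powr_mono') auto
    finally have "2 * (9 ^ m * exp (m - D * m)) * ?h powr q \<le> (1 / (8 * D)) powr q * A / 16 * ?h powr q"
      by (rule mult_right_mono) simp
    moreover have "3 ^ m * 3 ^ m = (9 :: real) ^ m" by (simp flip: power_mult_distrib)
    ultimately show ?thesis by (simp add: mult_ac)
  qed
  finally have error: "(\<Sum>k\<le>m. \<Sum>l\<le>m. ?c k * ?c l * ((s\<^sup>2) powr q * ?E ((k + l) * L)))
      - (\<Sum>k\<le>m. \<Sum>l\<le>m. ?c k * ?c l * V k l) \<le> (1 / (8 * D)) powr q * A / 16 * ?h powr q" .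
  \<comment> \<open>Since s^2 L m^2 = 1/(8 D), the Chebyshev gain m^(2q) exactly offsets the
    scaling, and neither m nor L remains.\<close>
  have "(1 / (8 * D)) powr q * A / 8 * ?h powr q = (s\<^sup>2) powr q * ((real L * ?h) powr q * (A * real m powr (2 * q)) / 8)"
  proof -
    have "real m powr (2 * q) = (real m)\<^sup>2 powr q" using m by (simp add: powr_powr flip: powr_numeral)
    moreover have "1 / (8 * D) * ?h = s\<^sup>2 * (real L * ?h) * (real m)\<^sup>2"
      unfolding s using D m L by (simp add: field_simps)
    then have "(1 / (8 * D)) powr q * ?h powr q = (s\<^sup>2) powr q * (real L * ?h) powr q * (real m)\<^sup>2 powr q"
      by (metis powr_mult)
    ultimately show ?thesis by simp
  qed
  also have "\<dots> \<le> (s\<^sup>2) powr q * (\<Sum>k\<le>m. \<Sum>l\<le>m. ?c k * ?c l * ?E ((k + l) * L))"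
    by (rule mult_left_mono[OF main]) simp
  also have "\<dots> = (\<Sum>k\<le>m. \<Sum>l\<le>m. ?c k * ?c l * ((s\<^sup>2) powr q * ?E ((k + l) * L)))"
    by (simp only: sum_distrib_left mult.left_commute[of "(s\<^sup>2) powr q"])
  finally have "(1 / (8 * D)) powr q * A / 16 * ?h powr q \<le> (\<Sum>k\<le>m. \<Sum>l\<le>m. ?c k * ?c l * V k l)"
    using error by simp
  then show ?thesis using energy by (meson ereal_less_eq(3) order_trans)
qed

section \<open>Choice of the constant and passage to the 2-summing norm\<close>

theorem proposition2p10:
  fixes p :: real
  assumes "0 < p" and "p < 2"
  shows "\<exists>C>0. \<forall>(n::nat) (N :: (nat \<Rightarrow> real) \<Rightarrow> real). is_norm n N \<longrightarrow>
           ereal (C * pi2 n N (norm2 n) (\<lambda>x. x) powr p)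
             \<le> max_energy p (unit_ball n N) (dist2 n)"
proof -
  define q where "q = p / 2"
  have q: "0 < q" "q < 1" and p: "p = 2 * q" using assms by (auto simp: q_def)
  obtain A where A: "0 < A" and cheb: "\<And>m. 1 \<le> m \<Longrightarrow>
      A * real m powr (2 * q) \<le> (\<Sum>k\<le>m. \<Sum>l\<le>m. coeff (cheb m) k * coeff (cheb m) l * real (k + l) powr q)"
    using cheb_energy_ge[OF q] by blast
  \<comment> \<open>Depends on A and thus on p only, and satisfies both smallness conditions on the
    truncation error.\<close>
  define D where "D = 5 + 512 * exp 5 / A"
  have D: "5 \<le> D" "512 * exp 5 \<le> A * D" using A by (auto simp: D_def field_simps)
  define C where "C = (1 / (8 * D)) powr q * A / 16"
  have C: "0 < C" using A D by (simp add: C_def)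
  have "ereal (C * pi2 n N (norm2 n) (\<lambda>x. x) powr p) \<le> max_energy p (unit_ball n N) (dist2 n)"
    if N: "is_norm n N" for n N
  \<comment> \<open>\<open>pi2_id_powr_le\<close> asks for a real bound. An infinite energy makes
    the claim trivial, and minus infinity contradicts nonnegativity.\<close>
  proof (cases "max_energy p (unit_ball n N) (dist2 n)")
    case (real r)
    have "0 \<le> r" using max_energy_unit_ball_nonneg[OF N, of p] real by simp
    then have "C * pi2 n N (norm2 n) (\<lambda>x. x) powr p \<le> r"
    proof (rule pi2_id_powr_le[OF N assms(1) C])
      fix m :: nat and x :: "nat \<Rightarrow> nat \<Rightarrow> real"
      assume x: "\<And>i. i < m \<Longrightarrow> x i \<in> Rn n"
        and ball: "\<And>Y. N (\<lambda>j. \<Sum>i<m. Y i * x i j) \<le> sqrt (\<Sum>i<m. (Y i)\<^sup>2)"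
      have "N (comb m x y) \<le> sqrt (sqnorm m y)" for y
        using ball[of y] by (simp add: comb_def sqnorm_def)
      from max_energy_ge_hs_sq[OF q A cheb D N x this]
      have "C * hs_sq n m x powr q \<le> r" using real unfolding C_def p by simp
      moreover have "sqrt (hs_sq n m x) powr p = hs_sq n m x powr q"
        by (simp add: p powr_powr flip: powr_half_sqrt)
      ultimately show "C * sqrt (\<Sum>i<m. (norm2 n (x i))\<^sup>2) powr p \<le> r" by (simp add: hs_sq_def)
    qed
    then show ?thesis using real by simp
  next
    case MInf
    then show ?thesis using max_energy_unit_ball_nonneg[OF N, of p] by simp
  qed simp
  then show ?thesis using C by blast
qed

end
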